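(* Let $f\in\mathcal{S}$ with $f(z)=z+a_2z^2+a_3z^3+\cdots$. Then \[-3\le \det T_{2,1}(f)\le 1 \quad\text{and}\quad -1\le \det T_{3,1}(f)\le 8,\] where $\det T_{2,1}(f)=1-|a_2|^2$ and $\det T_{3,1}(f)=2\,\mathrm{Re}(a_2^2\overline{a_3})-2|a_2|^2-|a_3|^2+1$. All four inequalities are sharp (attained by some function in $\mathcal{S}$).
   Context: $\mathbb{D}=\{z\in\mathbb{C}:|z|<1\}$. $\mathcal{A}$ is the class of analytic functions $f$ on $\mathbb{D}$ with $f(0)=0$, $f'(0)=1$, written $f(z)=z+a_2z^2+a_3z^3+\cdots$. $\mathcal{S}\subset\mathcal{A}$ is the class of functions in $\mathcal{A}$ that are univalent (injective) on $\mathbb{D}$. For $f\in\mathcal{A}$ (with $a_1=1$), the Hermitian Toeplitz matrices are $T_{2,1}(f)=\begin{pmatrix}1&a_2\\ \overline{a_2}&1\end{pmatrix}$ and $T_{3,1}(f)=\begin{pmatrix}1&a_2&a_3\\ \overline{a_2}&1&a_2\\ \overline{a_3}&\overline{a_2}&1\end{pmatrix}$; their determinants are real numbers (possibly negative), given by $\det T_{2,1}(f)=1-|a_2|^2$ and $\det T_{3,1}(f)=2\,\mathrm{Re}(a_2^2\overline{a_3})-2|a_2|^2-|a_3|^2+1$. *)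

theory Defs
  imports "HOL-Complex_Analysis.Complex_Analysis"
begin

definition classA :: "(complex \<Rightarrow> complex) \<Rightarrow> bool" where
  "classA f \<longleftrightarrow> f holomorphic_on ball 0 1 \<and> f 0 = 0 \<and> deriv f 0 = 1"

definition classS :: "(complex \<Rightarrow> complex) \<Rightarrow> bool" where
  "classS f \<longleftrightarrow> classA f \<and> inj_on f (ball 0 1)"

definition taylor_coeff :: "(complex \<Rightarrow> complex) \<Rightarrow> nat \<Rightarrow> complex" where
  "taylor_coeff f n = (deriv ^^ n) f 0 / of_nat (fact n)"

definition detT21 :: "(complex \<Rightarrow> complex) \<Rightarrow> real" where
  "detT21 f = 1 - (cmod (taylor_coeff f 2))\<^sup>2"

definition detT31 :: "(complex \<Rightarrow> complex) \<Rightarrow> real" where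
  "detT31 f = (let a2 = taylor_coeff f 2; a3 = taylor_coeff f 3 in
     2 * Re (a2\<^sup>2 * cnj a3) - 2 * (cmod a2)\<^sup>2 - (cmod a3)\<^sup>2 + 1)"

end

theory Submission
  imports Defs
begin

text \<open>
  With \<open>b = a\<^sub>2\<^sup>2 - a\<^sub>3\<close> one has \<open>det T\<^sub>3\<^sub>,\<^sub>1 = (|a\<^sub>2|\<^sup>2 - 1)\<^sup>2 - |b|\<^sup>2\<close>, so everything follows
  from \<open>|a\<^sub>2| \<le> 2\<close>, \<open>|b| \<le> 1\<close> and \<open>|a\<^sub>3| \<le> 3\<close>. All three come from a single discrete
  Loewner step, without a Loewner chain: for \<open>r < 1\<close> and \<open>\<sigma> < 1\<close> one can write
  \<open>f(r z) = (r/\<sigma>) g(\<phi>(z))\<close> with \<open>g\<close> again in the class \<open>S\<close> and \<open>\<phi>\<close> a self-map of the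
  disc with \<open>\<phi>(0) = 0\<close>, \<open>\<phi>'(0) = \<sigma>\<close>. The Schwarz-Pick lemma controls the first coefficients of
  \<open>\<phi>\<close>, and comparing coefficients bounds the supremum \<open>M\<close> of a suitable functional over
  \<open>S\<close> in terms of itself, by an inequality such as \<open>M \<le> \<sigma> M + O((1 - \<sigma>)\<^sup>2)\<close>; letting
  \<open>\<sigma> \<rightarrow> 1\<close> yields the sharp bound. Finiteness of \<open>M\<close> comes from Schottky's theorem.
  The functions \<open>z / (1 - c z + z\<^sup>2)\<close> with \<open>c = 0, 1, 2\<close> show sharpness.
\<close>

subsection \<open>Self-maps of the disc\<close>

lemma taylor_coeff_eq_fps_nth: "f has_fps_expansion F \<Longrightarrow> taylor_coeff f n = fps_nth F n"
  by (simp add: taylor_coeff_def fps_nth_fps_expansion)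

lemma has_fps_expansion_taylor:
  assumes "f holomorphic_on ball 0 1"
  shows "f has_fps_expansion Abs_fps (taylor_coeff f)"
proof -
  have "f has_fps_expansion fps_expansion f 0"
    using assms by (intro has_fps_expansion_fps_expansion[of "ball 0 1"]) auto
  moreover have "fps_expansion f 0 = Abs_fps (taylor_coeff f)"
    by (rule fps_ext) (simp add: fps_expansion_def taylor_coeff_def)
  ultimately show ?thesis by simp
qed

lemma taylor_coeff_0_1: "taylor_coeff f (Suc 0) = deriv f 0" "taylor_coeff f 0 = f 0"
  by (simp_all add: taylor_coeff_def)

lemma eventually_ball_at_0: "(\<And>z. z \<in> ball 0 1 \<Longrightarrow> P z) \<Longrightarrow> \<forall>\<^sub>F z in nhds (0::complex). P z"
  by (rule eventually_mono[OF eventually_nhds_in_open[of "ball 0 1"]]) auto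

text \<open>Maximum modulus: a value of modulus one inside the disc would make \<open>g\<close>
  constant, against \<open>cmod (g 0) < 1\<close>.\<close>

lemma holomorphic_norm_less_one:
  assumes g: "g holomorphic_on ball 0 1" and le: "\<And>z. z \<in> ball 0 1 \<Longrightarrow> cmod (g z) \<le> 1"
    and lt: "cmod (g 0) < 1" and w: "w \<in> ball 0 1"
  shows "cmod (g w) < 1"
proof (rule ccontr)
  assume "\<not> ?thesis"
  hence 1: "cmod (g w) = 1" using le[OF w] by simp
  have "g constant_on ball 0 1"
  proof (rule Schwarz2[OF g, of "1 - cmod w" w])
    show "ball w (1 - cmod w) \<subseteq> ball 0 1"
    proof
      fix z assume "z \<in> ball w (1 - cmod w)"
      hence "cmod (z - w) < 1 - cmod w" by (simp add: dist_norm norm_minus_commute)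
      thus "z \<in> ball 0 1" using norm_triangle_sub[of z w] by simp
    qed
    fix z assume "cmod (w - z) < 1 - cmod w"
    hence "cmod z < 1" using norm_triangle_ineq2[of z w] by (simp add: norm_minus_commute)
    thus "cmod (g z) \<le> cmod (g w)" using 1 le by simp
  qed (use w in auto)
  hence "g w = g 0" using w by (auto simp: constant_on_def)
  with 1 lt show False by simp
qed

text \<open>One step of the Schur algorithm: the Moebius map taking \<open>g 0\<close> to 0 makes
  the Schwarz lemma applicable, and division by z leaves a function bounded by one. The Moebius
  denominator is cleared so that Taylor coefficients can be compared directly.\<close>

lemma moebius_zero_factor:
  assumes g: "g holomorphic_on ball 0 1" and le: "\<And>z. z \<in> ball 0 1 \<Longrightarrow> cmod (g z) \<le> 1"
    and lt: "cmod (g 0) < 1"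
  obtains h where "h holomorphic_on ball 0 1" "\<And>z. z \<in> ball 0 1 \<Longrightarrow> cmod (h z) \<le> 1"
    "\<And>z. z \<in> ball 0 1 \<Longrightarrow> g z - g 0 = z * h z * (1 - cnj (g 0) * g z)"
proof -
  note less = holomorphic_norm_less_one[OF g le lt]
  let ?M = "Moebius_function 0 (g 0)"
  have hM: "(\<lambda>z. ?M (g z)) holomorphic_on ball 0 1"
    by (rule holomorphic_on_compose_gen[OF g Moebius_function_holomorphic[OF lt], unfolded o_def])
       (use less in auto)
  have M0: "?M (g 0) = 0" by (rule Moebius_function_eq_zero)
  have Mlt: "cmod (?M (g z)) < 1" if "cmod z < 1" for z
  proof -
    have "cmod (g z) < 1" using less that by simp
    thus ?thesis by (rule Moebius_function_norm_lt_1[OF lt])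
  qed
  obtain h where h: "h holomorphic_on ball 0 1" "\<And>z. cmod z < 1 \<Longrightarrow> ?M (g z) = z * h z"
      "deriv (\<lambda>z. ?M (g z)) 0 = h 0"
    by (rule Schwarz3[OF hM M0]; rule that; assumption)
  show thesis
  proof (rule that[OF h(1)])
    fix z :: complex assume z: "z \<in> ball 0 1"
    show "cmod (h z) \<le> 1"
    proof (cases "z = 0")
      case True
      have "cmod (deriv (\<lambda>z. ?M (g z)) 0) \<le> 1"
        by (rule Schwarz_Lemma(2)[OF hM M0 Mlt, of 0]) auto
      thus ?thesis using h(3) True by simp
    next
      case False
      have "cmod (?M (g z)) \<le> cmod z"
        by (rule Schwarz_Lemma(1)[OF hM M0 Mlt]) (use z in auto)
      hence "cmod (z * h z) \<le> cmod z" using h(2)[of z] z by simp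
      thus ?thesis using False by (simp add: norm_mult)
    qed
    have "cmod (cnj (g 0) * g z) < 1"
      using norm_mult_less[of "cnj (g 0)" 1 "g z" 1] lt less[OF _ z] by simp
    hence "1 - cnj (g 0) * g z \<noteq> 0" by auto
    thus "g z - g 0 = z * h z * (1 - cnj (g 0) * g z)"
      using h(2)[of z] z by (simp add: Moebius_function_simple eq_divide_eq divide_eq_eq)
  qed
qed

text \<open>The linear coefficient of the Schur factorisation gives
  \<open>deriv g 0 = h 0 * (1 - |g 0|^2)\<close> with \<open>h 0\<close> of modulus at most 1. If
  \<open>g 0\<close> has modulus 1, the maximum principle makes \<open>g\<close> constant.\<close>

lemma schwarz_pick_zero:
  assumes g: "g holomorphic_on ball 0 1" and le: "\<And>z. z \<in> ball 0 1 \<Longrightarrow> cmod (g z) \<le> 1"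
  shows "cmod (deriv g 0) \<le> 1 - (cmod (g 0))\<^sup>2"
proof (cases "cmod (g 0) < 1")
  case True
  obtain h where h: "h holomorphic_on ball 0 1" "\<And>z. z \<in> ball 0 1 \<Longrightarrow> cmod (h z) \<le> 1"
    "\<And>z. z \<in> ball 0 1 \<Longrightarrow> g z - g 0 = z * h z * (1 - cnj (g 0) * g z)"
    using moebius_zero_factor[OF g le True] by blast
  let ?G = "Abs_fps (taylor_coeff g)" and ?H = "Abs_fps (taylor_coeff h)"
  note G = has_fps_expansion_taylor[OF g] and H = has_fps_expansion_taylor[OF h(1)]
  have "(\<lambda>z. z * h z * (1 - cnj (g 0) * g z)) has_fps_expansion
      fps_X * ?H * (1 - fps_const (cnj (g 0)) * ?G)"
    by (intro fps_expansion_intros G H)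
  hence "(\<lambda>z. g z - g 0) has_fps_expansion fps_X * ?H * (1 - fps_const (cnj (g 0)) * ?G)"
    by (rule has_fps_expansion_cong[THEN iffD1, rotated -1])
       (auto intro!: eventually_ball_at_0 simp: h(3))
  moreover have "(\<lambda>z. g z - g 0) has_fps_expansion ?G - fps_const (g 0)"
    by (intro fps_expansion_intros G)
  ultimately have "?G - fps_const (g 0) = fps_X * ?H * (1 - fps_const (cnj (g 0)) * ?G)"
    by (metis fps_expansion_unique_complex)
  from arg_cong[OF this, of "\<lambda>F. fps_nth F 1"]
  have "deriv g 0 = h 0 * (1 - cnj (g 0) * g 0)"
    by (simp add: taylor_coeff_0_1 mult.assoc)
  also have "cnj (g 0) * g 0 = of_real ((cmod (g 0))\<^sup>2)"
    using complex_norm_square by (metis mult.commute)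
  finally have "cmod (deriv g 0) = cmod (h 0) * \<bar>1 - (cmod (g 0))\<^sup>2\<bar>"
    by (metis norm_mult norm_of_real of_real_1 of_real_diff)
  also have "\<dots> \<le> 1 * \<bar>1 - (cmod (g 0))\<^sup>2\<bar>"
    by (intro mult_right_mono h) auto
  also have "\<dots> = 1 - (cmod (g 0))\<^sup>2"
    using True by (simp add: abs_square_le_1 power_le_one)
  finally show ?thesis .
next
  case False
  hence 1: "cmod (g 0) = 1" using le[of 0] by simp
  have "g constant_on ball 0 1"
    using Schwarz2[OF g, of 1 0] le 1 by simp
  then obtain c where c: "\<And>z. z \<in> ball 0 1 \<Longrightarrow> g z = c" by (auto simp: constant_on_def)
  have "deriv g 0 = deriv (\<lambda>_. c) 0"
    by (intro deriv_cong_ev eventually_ball_at_0 c) auto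
  thus ?thesis using 1 by simp
qed

text \<open>The numbers \<open>\<sigma>\<close>, \<open>p\<close>, \<open>q / (1 - |p|\<^sup>2)\<close> are the first Schur parameters of
  \<open>\<phi>(z) / z\<close>.\<close>

lemma schur_coefficients:
  assumes phi: "\<phi> holomorphic_on ball 0 1" and into: "\<And>z. z \<in> ball 0 1 \<Longrightarrow> \<phi> z \<in> ball 0 1"
    and 0: "\<phi> 0 = 0" and d: "deriv \<phi> 0 = of_real \<sigma>" and sig: "0 < \<sigma>" "\<sigma> < 1"
  obtains p q where "cmod p \<le> 1" "cmod q \<le> 1 - (cmod p)\<^sup>2"
    "taylor_coeff \<phi> 2 = of_real (1 - \<sigma>\<^sup>2) * p"
    "taylor_coeff \<phi> 3 = of_real (1 - \<sigma>\<^sup>2) * (q - of_real \<sigma> * p\<^sup>2)"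
proof -
  have lt1: "cmod (\<phi> z) < 1" if "cmod z < 1" for z using into that by simp
  obtain w where w: "w holomorphic_on ball 0 1" "\<And>z. cmod z < 1 \<Longrightarrow> \<phi> z = z * w z"
      "deriv \<phi> 0 = w 0"
    by (rule Schwarz3[OF phi 0]; rule that; assumption)
  have w0: "w 0 = of_real \<sigma>" using w(3) d by simp
  have wle: "cmod (w z) \<le> 1" if z: "z \<in> ball 0 1" for z
  proof (cases "z = 0")
    case True
    thus ?thesis using sig w0 by simp
  next
    case False
    have "cmod (\<phi> z) \<le> cmod z"
      by (rule Schwarz_Lemma(1)[OF phi 0 lt1]) (use z in auto)
    hence "cmod (z * w z) \<le> cmod z" using w(2)[of z] z by simp
    thus ?thesis using False by (simp add: norm_mult)
  qed
  have "cmod (w 0) < 1" using w0 sig by simp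
  then obtain h where h: "h holomorphic_on ball 0 1" "\<And>z. z \<in> ball 0 1 \<Longrightarrow> cmod (h z) \<le> 1"
    "\<And>z. z \<in> ball 0 1 \<Longrightarrow> w z - w 0 = z * h z * (1 - cnj (w 0) * w z)"
    using moebius_zero_factor[OF w(1) wle] by blast
  let ?W = "Abs_fps (taylor_coeff w)" and ?H = "Abs_fps (taylor_coeff h)" and ?s = "complex_of_real \<sigma>"
  note W = has_fps_expansion_taylor[OF w(1)] and H = has_fps_expansion_taylor[OF h(1)]
  have "(\<lambda>z. z * h z * (1 - ?s * w z)) has_fps_expansion
      fps_X * ?H * (1 - fps_const ?s * ?W)"
    by (intro fps_expansion_intros H W)
  hence "(\<lambda>z. w z - ?s) has_fps_expansion fps_X * ?H * (1 - fps_const ?s * ?W)"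
    by (rule has_fps_expansion_cong[THEN iffD1, rotated -1])
       (use h(3) in \<open>auto intro!: eventually_ball_at_0 simp: w0\<close>)
  moreover have "(\<lambda>z. w z - ?s) has_fps_expansion ?W - fps_const ?s"
    by (intro fps_expansion_intros W)
  ultimately have WH: "?W - fps_const ?s = fps_X * (?H * (1 - fps_const ?s * ?W))"
    by (metis fps_expansion_unique_complex mult.assoc)
  have "(\<lambda>z. z * w z) has_fps_expansion fps_X * ?W"
    by (intro fps_expansion_intros W)
  hence "\<phi> has_fps_expansion fps_X * ?W"
    by (rule has_fps_expansion_cong[THEN iffD1, rotated -1])
       (use w(2) in \<open>auto intro!: eventually_ball_at_0\<close>)
  hence tP: "taylor_coeff \<phi> n = fps_nth (fps_X * ?W) n" for n
    by (rule taylor_coeff_eq_fps_nth)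
  have W0: "taylor_coeff w 0 = ?s" using w0 by (simp add: taylor_coeff_0_1)
  have c1: "taylor_coeff w 1 = h 0 * (1 - ?s * ?s)"
    using arg_cong[OF WH, of "\<lambda>F. fps_nth F 1"] by (simp add: W0[unfolded taylor_coeff_0_1] taylor_coeff_0_1)
  have c2: "taylor_coeff w 2 = deriv h 0 * (1 - ?s * ?s) - h 0 * (?s * taylor_coeff w 1)"
    using arg_cong[OF WH, of "\<lambda>F. fps_nth F 2"]
    by (simp add: W0[unfolded taylor_coeff_0_1] taylor_coeff_0_1 fps_mult_nth eval_nat_numeral)
  show thesis
  \<comment> \<open>Schwarz-Pick applied to \<open>h\<close> couples the two parameters and gives
    the bound on \<open>q\<close>.\<close>
  proof (rule that[of "h 0" "deriv h 0"])
    show "cmod (h 0) \<le> 1" using h(2) by simp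
    show "cmod (deriv h 0) \<le> 1 - (cmod (h 0))\<^sup>2" by (rule schwarz_pick_zero[OF h(1,2)])
    show t2: "taylor_coeff \<phi> 2 = of_real (1 - \<sigma>\<^sup>2) * h 0"
      unfolding tP using c1 by (simp add: power2_eq_square)
    have "taylor_coeff \<phi> 3 = taylor_coeff w 2" unfolding tP by simp
    also have "\<dots> = of_real (1 - \<sigma>\<^sup>2) * (deriv h 0 - of_real \<sigma> * (h 0)\<^sup>2)"
      unfolding c2 c1 by (simp add: power2_eq_square algebra_simps)
    finally show "taylor_coeff \<phi> 3 = of_real (1 - \<sigma>\<^sup>2) * (deriv h 0 - of_real \<sigma> * (h 0)\<^sup>2)" .
  qed
qed

subsection \<open>Riemann maps of complements of discs\<close>

text \<open>The complement of \<open>K\<close> in the Riemann sphere, seen through \<open>w \<mapsto> 1/w\<close>; the point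
  \<open>0\<close> stands for \<open>\<infinity>\<close> and is added by hand because \<open>inverse 0 = 0\<close>.\<close>

definition inverted_complement :: "complex set \<Rightarrow> complex set" where
  "inverted_complement K = {w. w = 0 \<or> inverse w \<notin> K}"

lemma open_inverse_preimage:
  assumes "open T" shows "open {w::complex. w \<noteq> 0 \<and> inverse w \<in> T}"
proof -
  have "open ((-{0}) \<inter> inverse -` T)"
    by (intro continuous_open_preimage continuous_intros assms) auto
  also have "(-{0}) \<inter> inverse -` T = {w. w \<noteq> 0 \<and> inverse w \<in> T}" by auto
  finally show ?thesis .
qed

lemma open_inverted_complement:
  assumes "compact K" shows "open (inverted_complement K)"
proof -
  obtain B where B: "B > 0" "\<And>x. x \<in> K \<Longrightarrow> cmod x \<le> B"
    using compact_imp_bounded[OF assms] by (auto simp: bounded_pos)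
  \<comment> \<open>Boundedness of \<open>K\<close> supplies a neighbourhood of the added point 0;
    elsewhere openness is that of an inverse preimage.\<close>
  have "ball 0 (inverse B) \<union> {w. w \<noteq> 0 \<and> inverse w \<in> -K} = inverted_complement K"
  proof (intro equalityI subsetI)
    fix w assume "w \<in> ball 0 (inverse B) \<union> {w. w \<noteq> 0 \<and> inverse w \<in> -K}"
    moreover have "inverse w \<notin> K" if "cmod w < inverse B" "w \<noteq> 0"
    proof
      assume "inverse w \<in> K"
      hence "inverse (cmod w) \<le> B" using B(2) by (metis norm_inverse)
      moreover have "B < inverse (cmod w)"
        using that B(1) less_imp_inverse_less[of "cmod w" "inverse B"] by simp
      ultimately show False by simp
    qed
    ultimately show "w \<in> inverted_complement K" by (auto simp: inverted_complement_def)
  next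
    fix w assume "w \<in> inverted_complement K"
    thus "w \<in> ball 0 (inverse B) \<union> {w. w \<noteq> 0 \<and> inverse w \<in> -K}"
      using B(1) by (auto simp: inverted_complement_def)
  qed
  moreover have "open (ball 0 (inverse B) \<union> {w. w \<noteq> 0 \<and> inverse w \<in> -K})"
    using assms by (intro open_Un open_inverse_preimage) (auto simp: compact_imp_closed open_Compl)
  ultimately show ?thesis by simp
qed

lemma inverted_complement_antimono: "K \<subseteq> L \<Longrightarrow> inverted_complement L \<subseteq> inverted_complement K"
  by (auto simp: inverted_complement_def)

lemma bounded_inverted_complement:
  assumes "0 \<in> interior K" shows "bounded (inverted_complement K)"
proof -
  obtain e where e: "e > 0" "ball 0 e \<subseteq> K" using assms by (auto simp: mem_interior)
  have "cmod w \<le> inverse e" if "w \<in> inverted_complement K" for w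
  proof (cases "w = 0")
    case False
    hence "inverse w \<notin> ball 0 e" using that e by (auto simp: inverted_complement_def)
    hence "e \<le> inverse (cmod w)" by (simp add: norm_inverse)
    thus ?thesis using e(1) False le_imp_inverse_le[of e "inverse (cmod w)"] by simp
  qed (use e in simp)
  thus ?thesis by (auto simp: bounded_iff)
qed

section \<open>Images of discs under univalent maps\<close>

lemma connected_compl_image_cball:
  fixes f :: "complex \<Rightarrow> complex"
  assumes "continuous_on (cball 0 r) f" "inj_on f (cball 0 r)"
  shows "connected (- f ` cball 0 r)"
proof -
  \<comment> \<open>The image is a compact set homeomorphic to a convex one, and such a set does not
    separate the plane.\<close>
  have "cball (0::complex) r homeomorphic f ` cball 0 r"
    by (rule homeomorphic_compact[OF compact_cball assms(1) refl assms(2)])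
  hence "f ` cball 0 r homeomorphic cball (0::complex) r" by (rule homeomorphic_sym[THEN iffD1])
  thus ?thesis by (rule connected_complement_homeomorphic_convex_compact) auto
qed

text \<open>The derivative at 0 is left free so that the locale also covers Riemann maps, whose
  derivative at 0 is the conformal radius.\<close>

locale univalent_disc =
  fixes f :: "complex \<Rightarrow> complex"
  assumes hol: "f holomorphic_on ball 0 1" and zero: "f 0 = 0" and inj: "inj_on f (ball 0 1)"
begin

lemma cball_subset: "r < 1 \<Longrightarrow> cball 0 r \<subseteq> ball (0::complex) 1" by auto

lemma cont: "r < 1 \<Longrightarrow> continuous_on (cball 0 r) f"
  using hol cball_subset by (meson continuous_on_subset holomorphic_on_imp_continuous_on)

lemma isCont: "z \<in> ball 0 1 \<Longrightarrow> isCont f z"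
  using holomorphic_on_imp_continuous_on[OF hol] continuous_on_eq_continuous_at[OF open_ball] by blast

lemma inj_cball: "r < 1 \<Longrightarrow> inj_on f (cball 0 r)"
  using inj cball_subset inj_on_subset by metis

lemma compact_image: "r < 1 \<Longrightarrow> compact (f ` cball 0 r)"
  by (intro compact_continuous_image cont) auto

lemma open_image: "r \<le> 1 \<Longrightarrow> open (f ` ball 0 r)"
  by (rule open_mapping_thm3)
     (auto intro: holomorphic_on_subset[OF hol] inj_on_subset[OF inj])

lemma eq_zero_iff: "z \<in> ball 0 1 \<Longrightarrow> f z = 0 \<longleftrightarrow> z = 0"
  using inj_on_eq_iff[OF inj, of z 0] zero by simp

lemma zero_interior:
  assumes "0 < r" "r < 1" shows "0 \<in> interior (f ` cball 0 r)"
proof (rule interiorI)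
  show "open (f ` ball 0 r)" using open_image assms by simp
  show "0 \<in> f ` ball 0 r" using assms zero by (intro image_eqI[of _ _ 0]) auto
  show "f ` ball 0 r \<subseteq> f ` cball 0 r" by auto
qed

text \<open>A bounded open plane set is simply connected iff it and its complement are connected.
  Inversion reduces the first to the complement of the image of the closed disc, with the limit
  point 0 added, and the second to the image of the punctured disc.\<close>

lemma simply_connected_inverted_complement:
  assumes r: "0 < r" "r < 1"
  shows "simply_connected (inverted_complement (f ` cball 0 r))"
proof -
  let ?K = "f ` cball 0 r" and ?U = "inverted_complement (f ` cball 0 r)"
  have op: "open ?U" by (intro open_inverted_complement compact_image r)
  have 0: "0 \<in> ?K" using zero_interior[OF r] interior_subset by blast
  have "connected (inverse ` (- ?K))"
    by (intro connected_continuous_image connected_compl_image_cball continuous_intros cont inj_cball r)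
       (use 0 in auto)
  also have "inverse ` (- ?K) = ?U - {0}"
  proof (intro equalityI subsetI)
    fix w assume "w \<in> ?U - {0}"
    thus "w \<in> inverse ` (- ?K)" by (intro image_eqI[of _ _ "inverse w"]) (auto simp: inverted_complement_def)
  qed (use 0 in \<open>auto simp: inverted_complement_def\<close>)
  finally have c1: "connected (?U - {0})" .
  have "0 \<in> ?U" by (simp add: inverted_complement_def)
  hence "0 islimpt ?U" using op by (simp add: interior_limit_point interior_open)
  hence "0 \<in> closure (?U - {0})" by (simp add: islimpt_in_closure)
  hence "?U \<subseteq> closure (?U - {0})" using closure_subset[of "?U - {0}"] by auto
  hence cU: "connected ?U" by (intro connected_intermediate_closure[OF c1]) auto
  have "connected (cball (0::complex) r - {0})"
    using r by (intro connected_punctured_convex) (auto simp: aff_dim_cball)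
  hence "connected (f ` (cball 0 r - {0}))"
    by (intro connected_continuous_image continuous_on_subset[OF cont]) (use r in auto)
  moreover have "0 \<notin> f ` (cball 0 r - {0})"
    using eq_zero_iff cball_subset[OF r(2)] by (auto simp: subset_iff)
  ultimately have "connected (inverse ` (f ` (cball 0 r - {0})))"
    by (intro connected_continuous_image[of "f ` (cball 0 r - {0})"] continuous_on_inverse continuous_on_id) auto
  also have "inverse ` (f ` (cball 0 r - {0})) = - ?U"
  proof (intro equalityI subsetI)
    fix w assume "w \<in> - ?U"
    then obtain z where z: "z \<in> cball 0 r" "inverse w = f z" "w \<noteq> 0"
      by (auto simp: inverted_complement_def)
    hence "z \<noteq> 0" using zero by auto
    moreover have "w = inverse (f z)" using z by (metis inverse_inverse_eq)
    ultimately show "w \<in> inverse ` (f ` (cball 0 r - {0}))" using z by blast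
  qed (use eq_zero_iff cball_subset[OF r(2)] in \<open>auto simp: inverted_complement_def subset_iff\<close>)
  finally show ?thesis
    using simply_connected_iff_simple[OF op bounded_inverted_complement[OF zero_interior[OF r]]] cU
    by simp
qed

end

text \<open>The map from the Riemann mapping theorem is composed with a disc automorphism to fix 0
  and with a rotation to make the derivative there positive.\<close>

lemma riemann_map_zero:
  assumes S: "open S" "simply_connected S" "bounded S" "0 \<in> S"
  obtains F G c where "univalent_disc F" "F ` ball 0 1 = S" "G holomorphic_on S"
    "G ` S \<subseteq> ball 0 1" "G 0 = 0" "\<And>w. w \<in> S \<Longrightarrow> F (G w) = w" "\<And>z. z \<in> ball 0 1 \<Longrightarrow> G (F z) = z"
    "c > 0" "deriv F 0 = of_real c"
proof -
  have "S \<noteq> UNIV" using S(3) not_bounded_UNIV by blast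
  then obtain f g where fg: "f holomorphic_on S" "g holomorphic_on ball 0 1"
      "\<And>z. z \<in> S \<Longrightarrow> f z \<in> ball 0 1 \<and> g (f z) = z"
      "\<And>z. z \<in> ball 0 1 \<Longrightarrow> g z \<in> S \<and> f (g z) = z"
    using Riemann_mapping_theorem[of S] S by blast
  have f0: "f 0 \<in> ball 0 1" using fg S by blast
  obtain m n where mn: "m (f 0) = 0" "m holomorphic_on ball 0 1" "m ` ball 0 1 \<subseteq> ball 0 1"
      "n holomorphic_on ball 0 1" "n ` ball 0 1 \<subseteq> ball 0 1"
      "\<And>z. z \<in> ball 0 1 \<Longrightarrow> m (n z) = z" "\<And>z. z \<in> ball 0 1 \<Longrightarrow> n (m z) = z"
    by (rule ball_biholomorphism_exists[OF f0]) blast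
  have n0: "n 0 = f 0" using mn(1,7) f0 by metis
  define H where "H = g \<circ> n"
  have H: "H holomorphic_on ball 0 1" unfolding H_def
    by (rule holomorphic_on_compose_gen[OF mn(4) fg(2) mn(5)])
  have H0: "H 0 = 0" using n0 fg(3)[OF S(4)] by (simp add: H_def)
  have nb: "n z \<in> ball 0 1" if "z \<in> ball 0 1" for z using mn(5) that by blast
  have mb: "m z \<in> ball 0 1" if "z \<in> ball 0 1" for z using mn(3) that by blast
  have mfH: "m (f (H z)) = z" if "z \<in> ball 0 1" for z
    using fg(4)[OF nb[OF that]] mn(6)[OF that] by (simp add: H_def)
  have injH: "inj_on H (ball 0 1)" by (rule inj_on_inverseI[of _ "\<lambda>w. m (f w)"]) (rule mfH)
  have dH: "deriv H 0 \<noteq> 0"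
    by (rule holomorphic_injective_imp_regular[OF H _ injH]) auto
  define u where "u = cnj (sgn (deriv H 0))"
  have cu: "cmod u = 1" using dH by (simp add: u_def norm_sgn)
  hence u0: "u \<noteq> 0" by auto
  define F where "F z = H (u * z)" for z
  define G where "G w = inverse u * m (f w)" for w
  have ub: "u * z \<in> ball 0 1 \<longleftrightarrow> z \<in> ball 0 1" "inverse u * z \<in> ball 0 1 \<longleftrightarrow> z \<in> ball 0 1" for z
    using cu by (simp_all add: norm_mult norm_inverse)
  have GF: "G (F z) = z" if "z \<in> ball 0 1" for z
    using mfH[of "u * z"] ub(1)[of z] that u0 by (simp add: F_def G_def)
  have FG: "F (G w) = w" if "w \<in> S" for w
    using fg(3)[OF that] mn(7)[of "f w"] u0
    by (simp add: F_def G_def H_def mult.assoc[symmetric] del: mult.assoc)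
  have GS: "G w \<in> ball 0 1" if "w \<in> S" for w
    using fg(3)[OF that] mb ub(2) by (simp add: G_def)
  have FS: "F z \<in> S" if "z \<in> ball 0 1" for z
    using fg(4)[OF nb] ub(1)[of z] that by (simp add: F_def H_def)
  have holF: "F holomorphic_on ball 0 1"
    unfolding F_def
    by (rule holomorphic_on_compose_gen[OF _ H, unfolded o_def]) (use ub in \<open>auto intro!: holomorphic_intros\<close>)
  have holG: "G holomorphic_on S"
  proof -
    have "(\<lambda>w. m (f w)) holomorphic_on S"
      by (rule holomorphic_on_compose_gen[OF fg(1) mn(2), unfolded o_def]) (use fg(3) in auto)
    thus ?thesis unfolding G_def by (intro holomorphic_intros)
  qed
  have "H field_differentiable at 0"
    using H by (rule holomorphic_on_imp_differentiable_at) auto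
  hence "(H has_field_derivative deriv H 0) (at (u * 0))" by (simp add: DERIV_deriv_iff_field_differentiable)
  hence "(F has_field_derivative deriv H 0 * u) (at 0)"
    unfolding F_def by (rule DERIV_chain2) (auto intro!: derivative_eq_intros)
  hence "deriv F 0 = deriv H 0 * u" by (rule DERIV_imp_deriv)
  also have "\<dots> = of_real (cmod (deriv H 0))"
    using complex_norm_square[of "deriv H 0"] dH
    by (simp add: u_def sgn_eq power2_eq_square divide_simps)
  finally have dF: "deriv F 0 = of_real (cmod (deriv H 0))" .
  show thesis
  proof (rule that[of F G "cmod (deriv H 0)"])
    show "univalent_disc F"
      using holF H0 GF by unfold_locales (auto simp: F_def intro: inj_on_inverseI[of _ G])
    show "F ` ball 0 1 = S"
      using FS GS FG by (auto simp: image_iff) (metis mem_ball_0)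
    show "G ` S \<subseteq> ball 0 1" using GS by blast
    show "G 0 = 0" using mn(1) by (simp add: G_def)
  qed (use holG FG GF dF dH in auto)
qed

lemma (in univalent_disc) riemann_map_inverted_complement:
  assumes r: "0 < r" "r < 1"
  defines "S \<equiv> inverted_complement (f ` cball 0 r)"
  obtains F G c where "univalent_disc F" "F ` ball 0 1 = S" "G holomorphic_on S"
    "G ` S \<subseteq> ball 0 1" "G 0 = 0" "\<And>w. w \<in> S \<Longrightarrow> F (G w) = w" "\<And>z. z \<in> ball 0 1 \<Longrightarrow> G (F z) = z"
    "c > 0" "deriv F 0 = of_real c"
proof -
  have S: "open S" "simply_connected S" "bounded S" "0 \<in> S"
    using r zero_interior[OF r] unfolding S_def
    by (simp_all add: open_inverted_complement compact_image simply_connected_inverted_complement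
        bounded_inverted_complement) (simp add: inverted_complement_def)
  show thesis by (rule riemann_map_zero[OF S]; rule that; assumption)
qed

subsection \<open>Continuity of the conformal radius\<close>

text \<open>The conformal radius of \<open>S\<close> at \<open>0\<close> is at least \<open>c\<close>. No injectivity is required of
  the competing maps, by the Schwarz lemma.\<close>

definition admits_radius :: "complex set \<Rightarrow> real \<Rightarrow> bool" where
  "admits_radius S c \<longleftrightarrow> (\<exists>F. F holomorphic_on ball 0 1 \<and> F 0 = 0 \<and> F ` ball 0 1 \<subseteq> S \<and> c \<le> cmod (deriv F 0))"

lemma uniform_limit_deriv_0:
  assumes hol: "\<And>n::nat. F n holomorphic_on ball 0 1"
    and lim: "\<And>K. compact K \<Longrightarrow> K \<subseteq> ball 0 1 \<Longrightarrow> uniform_limit K F g sequentially"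
  shows "(\<lambda>n. deriv (F n) 0) \<longlonglongrightarrow> deriv g 0"
proof (rule deriv_complex_uniform_limit)
  have "uniform_limit (cball 0 (1/2)) F g sequentially" by (rule lim) auto
  thus "uniform_limit (ball 0 (1/2)) F g sequentially" by (rule uniform_limit_on_subset) auto
  show "\<forall>\<^sub>F n in sequentially. F n holomorphic_on ball 0 (1/2)"
    by (intro always_eventually allI holomorphic_on_subset[OF hol]) auto
qed auto

context univalent_disc
begin

abbreviation outer :: "real \<Rightarrow> complex set" where
  "outer q \<equiv> inverted_complement (f ` cball 0 q)"

text \<open>For small \<open>q\<close> the image of the disc lies within radius 1/c, so
  \<open>outer q\<close> contains the disc of radius \<open>c\<close> and multiplication by
  \<open>c\<close> is a competing map.\<close>

lemma admits_radius_small: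
  assumes c: "c > 0"
  obtains q where "0 < q" "q < 1" "admits_radius (outer q) c"
proof -
  have "isCont f 0" by (rule isCont) simp
  then obtain d where d: "d > 0" "\<And>z. cmod z < d \<Longrightarrow> cmod (f z) < inverse c"
    using c zero unfolding continuous_at_eps_delta
    by (metis dist_0_norm dist_commute positive_imp_inverse_positive)
  define q where "q = min (d / 2) (1 / 2)"
  have q: "0 < q" "q < 1" "q < d" using d by (auto simp: q_def)
  have "of_real c * z \<in> outer q" if z: "z \<in> ball 0 1" for z
  proof (cases "z = 0")
    case False
    have "inverse (of_real c * z) \<noteq> f y" if y: "y \<in> cball 0 q" for y
    proof
      assume e: "inverse (of_real c * z) = f y"
      have "cmod (f y) < inverse c" using d(2) y q by simp
      hence "inverse c * inverse (cmod z) < inverse c * 1"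
        using c by (simp add: e[symmetric] norm_inverse norm_mult)
      hence "inverse (cmod z) < 1" using c by (simp add: mult_less_cancel_left)
      thus False using z False one_le_inverse[of "cmod z"] by simp
    qed
    thus ?thesis unfolding inverted_complement_def by blast
  qed (simp add: inverted_complement_def)
  moreover have "deriv (\<lambda>z. of_real c * z) 0 = (of_real c :: complex)"
    by (rule DERIV_imp_deriv) (auto intro!: derivative_eq_intros)
  ultimately have "admits_radius (outer q) c"
    unfolding admits_radius_def using c
    by (intro exI[of _ "\<lambda>z. of_real c * z"]) (auto intro!: holomorphic_intros)
  with q that show thesis by blast
qed

text \<open>Montel's theorem: the competing maps are uniformly bounded because their targets lie in
  \<open>outer (p / 2)\<close>, and a limit map keeps the derivative bound. Limits of values may
  reach the boundary, so only the image of the open disc is avoided. The case p = 1 is included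
  because the Loewner step has to exclude it.\<close>

lemma admits_radius_limit:
  assumes p: "0 < p" "p \<le> 1" and c: "c > 0"
    and ex: "\<And>s. s < p \<Longrightarrow> \<exists>q. s < q \<and> q < 1 \<and> admits_radius (outer q) c"
  obtains F where "F holomorphic_on ball 0 1" "F 0 = 0" "c \<le> cmod (deriv F 0)"
    "\<And>z. z \<in> ball 0 1 \<Longrightarrow> F z = 0 \<or> inverse (F z) \<notin> f ` ball 0 p"
proof -
  \<comment> \<open>Levels tending to \<open>p\<close> from below, starting at p/2.\<close>
  define s where "s n = p * (1 - inverse (real (Suc (Suc n))))" for n
  have s: "p / 2 \<le> s n" "s n < p" for n
    using p by (auto simp: s_def field_simps)
  have "\<exists>q F. s n < q \<and> q < 1 \<and> F holomorphic_on ball 0 1 \<and> F 0 = 0 \<and> F ` ball 0 1 \<subseteq> outer q \<and> c \<le> cmod (deriv F 0)" for n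
    using ex[OF s(2)[of n]] unfolding admits_radius_def by blast
  then obtain q F where qF: "\<And>n. s n < q n" "\<And>n. q n < 1" "\<And>n. F n holomorphic_on ball 0 1"
    "\<And>n. F n 0 = 0" "\<And>n. F n ` ball 0 1 \<subseteq> outer (q n)" "\<And>n. c \<le> cmod (deriv (F n) 0)"
    by metis
  have p2: "0 < p / 2" "p / 2 < 1" using p by auto
  obtain B where B: "\<And>w. w \<in> outer (p / 2) \<Longrightarrow> cmod w \<le> B"
    using bounded_inverted_complement[OF zero_interior[OF p2]] by (auto simp: bounded_iff)
  have FB: "cmod (F n z) \<le> B" if "z \<in> ball 0 1" for n z
  proof -
    have "p / 2 \<le> q n" using s(1)[of n] qF(1)[of n] by linarith
    hence "f ` cball 0 (p / 2) \<subseteq> f ` cball 0 (q n)" by (intro image_mono) auto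
    hence "outer (q n) \<subseteq> outer (p / 2)" by (rule inverted_complement_antimono)
    thus ?thesis using B qF(5)[of n] that by blast
  qed
  obtain g \<rho> where g: "g holomorphic_on ball 0 1" "strict_mono (\<rho> :: nat \<Rightarrow> nat)"
      "\<And>x. x \<in> ball 0 1 \<Longrightarrow> (\<lambda>n. F (\<rho> n) x) \<longlonglongrightarrow> g x"
      "\<And>K. compact K \<Longrightarrow> K \<subseteq> ball 0 1 \<Longrightarrow> uniform_limit K (F \<circ> \<rho>) g sequentially"
  proof (rule Montel[of "ball 0 1" "range F" F])
    show "\<exists>B. \<forall>h\<in>range F. \<forall>z\<in>K. cmod (h z) \<le> B" if "compact K" "K \<subseteq> ball 0 1" for K
      using FB that by blast
  qed (use qF(3) in \<open>auto\<close>)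
  have "(\<lambda>n. deriv ((F \<circ> \<rho>) n) 0) \<longlonglongrightarrow> deriv g 0"
    by (rule uniform_limit_deriv_0[OF _ g(4)]) (simp add: qF(3))
  hence "(\<lambda>n. cmod (deriv ((F \<circ> \<rho>) n) 0)) \<longlonglongrightarrow> cmod (deriv g 0)" by (rule tendsto_norm)
  hence dg: "c \<le> cmod (deriv g 0)"
    by (rule LIMSEQ_le_const) (use qF(6) in auto)
  have "(\<lambda>n. F (\<rho> n) 0) \<longlonglongrightarrow> g 0" by (rule g) auto
  hence "(\<lambda>n. 0) \<longlonglongrightarrow> g 0" using qF(4) by simp
  hence g0: "g 0 = 0" by (rule LIMSEQ_unique[OF _ tendsto_const])
  have "inverse (g z) \<notin> f ` ball 0 p" if z: "z \<in> ball 0 1" "g z \<noteq> 0" for z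
  proof
    assume "inverse (g z) \<in> f ` ball 0 p"
    then obtain y where y: "cmod y < p" "inverse (g z) = f y" by auto
    obtain t where t: "cmod y < t" "t < p" using y(1) dense by blast
    let ?X = "{w. w \<noteq> 0 \<and> inverse w \<in> f ` ball 0 t}"
    have "open ?X" using t p by (intro open_inverse_preimage open_image) auto
    moreover have "g z \<in> ?X" using z y t by auto
    ultimately have ev: "\<forall>\<^sub>F n in sequentially. F (\<rho> n) z \<in> ?X"
      using g(3)[OF z(1)] topological_tendstoD by blast
    have "(\<lambda>n. s (\<rho> n)) \<longlonglongrightarrow> p"
    proof -
      have "(\<lambda>n. p * (1 - inverse (real (Suc (Suc n))))) \<longlonglongrightarrow> p * (1 - 0)"
        by (intro tendsto_intros LIMSEQ_Suc[OF LIMSEQ_inverse_real_of_nat])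
      hence "s \<longlonglongrightarrow> p" by (simp add: s_def[abs_def])
      thus ?thesis using LIMSEQ_subseq_LIMSEQ[OF _ g(2)] by (simp add: o_def)
    qed
    hence "\<forall>\<^sub>F n in sequentially. t < s (\<rho> n)" using t(2) by (rule order_tendstoD)
    with ev have "\<forall>\<^sub>F n in sequentially. F (\<rho> n) z \<in> ?X \<and> t < s (\<rho> n)"
      by (rule eventually_conj)
    then obtain n where n: "F (\<rho> n) z \<in> ?X" "t < s (\<rho> n)"
      by (metis (mono_tags, lifting) eventually_sequentially order_refl)
    have "F (\<rho> n) z \<in> outer (q (\<rho> n))" using qF(5) z(1) by blast
    moreover have "f ` ball 0 t \<subseteq> f ` cball 0 (q (\<rho> n))"
      using n(2) qF(1)[of "\<rho> n"] by (intro image_mono) auto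
    ultimately show False using n(1) by (auto simp: inverted_complement_def)
  qed
  with g(1) g0 dg that show thesis by blast
qed

text \<open>Open mapping theorem: the limit map is nonconstant because \<open>c\<close> is positive.
  If it took the value 1/f(y) with y in the closed disc of radius \<open>p\<close>, it would also
  take 1/f(t y) for t < 1 close to 1, and these values are already excluded.\<close>

lemma admits_radius_closed:
  assumes p: "0 < p" "p < 1" and c: "c > 0"
    and ex: "\<And>s. s < p \<Longrightarrow> \<exists>q. s < q \<and> q < 1 \<and> admits_radius (outer q) c"
  shows "admits_radius (outer p) c"
proof -
  obtain F where F: "F holomorphic_on ball 0 1" "F 0 = 0" "c \<le> cmod (deriv F 0)"
    "\<And>z. z \<in> ball 0 1 \<Longrightarrow> F z = 0 \<or> inverse (F z) \<notin> f ` ball 0 p"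
    using admits_radius_limit[of p c] p c ex less_imp_le by metis
  have "\<not> F constant_on ball 0 1"
  proof
    assume "F constant_on ball 0 1"
    then obtain k where "\<And>z. z \<in> ball 0 1 \<Longrightarrow> F z = k" by (auto simp: constant_on_def)
    hence "deriv F 0 = deriv (\<lambda>_. k) 0"
      by (intro deriv_cong_ev eventually_ball_at_0) auto
    thus False using F(3) c by simp
  qed
  hence opF: "open (F ` ball 0 1)" by (intro open_mapping_thm[OF F(1)]) auto
  have "F z \<in> outer p" if z: "z \<in> ball 0 1" for z
  proof (rule ccontr)
    assume "F z \<notin> outer p"
    then obtain y where y: "cmod y \<le> p" "inverse (F z) = f y" "F z \<noteq> 0"
      by (auto simp: inverted_complement_def)
    have y0: "y \<noteq> 0" using y zero by auto
    have yb: "y \<in> ball 0 1" using y p by auto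
    have fy: "f y \<noteq> 0" using eq_zero_iff[OF yb] y0 by simp
    have "isCont f y" by (rule isCont[OF yb])
    hence "isCont (\<lambda>t. inverse (f (of_real t * y))) (1::real)"
      by (intro continuous_intros isCont_o2[of _ "\<lambda>t. of_real t * y" f]) (use fy in auto)
    hence "((\<lambda>t. inverse (f (of_real t * y))) \<longlongrightarrow> inverse (f y)) (at_left (1::real))"
      by (auto simp: isCont_def intro: tendsto_within_subset)
    moreover have "inverse (f y) = F z" using y(2) by (metis inverse_inverse_eq)
    ultimately have "\<forall>\<^sub>F t in at_left (1::real). inverse (f (of_real t * y)) \<in> F ` ball 0 1"
      using opF z topological_tendstoD by fastforce
    moreover have "\<forall>\<^sub>F t in at_left (1::real). t \<in> {0<..<1}"
      by (rule eventually_at_left_1) auto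
    ultimately have "\<forall>\<^sub>F t in at_left (1::real). inverse (f (of_real t * y)) \<in> F ` ball 0 1 \<and> t \<in> {0<..<1}"
      by (rule eventually_conj)
    then obtain t :: real where "inverse (f (of_real t * y)) \<in> F ` ball 0 1 \<and> t \<in> {0<..<1}"
      using eventually_happens'[OF trivial_limit_at_left_real] by blast
    hence t: "inverse (f (of_real t * y)) \<in> F ` ball 0 1" "0 < t" "t < 1" by auto
    obtain x where x: "x \<in> ball 0 1" "inverse (f (of_real t * y)) = F x" using t(1) by auto
    have ty: "cmod (of_real t * y) < p"
    proof -
      have "t * cmod y < 1 * cmod y" using t y0 by (intro mult_strict_right_mono) auto
      thus ?thesis using y(1) t by (simp add: norm_mult)
    qed
    hence "f (of_real t * y) \<noteq> 0" using eq_zero_iff[of "of_real t * y"] p y0 t by auto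
    hence "F x \<noteq> 0" "inverse (F x) = f (of_real t * y)" using x(2) by (metis inverse_nonzero_iff_nonzero, metis inverse_inverse_eq)
    thus False using F(4)[OF x(1)] ty by auto
  qed
  thus ?thesis using F by (auto simp: admits_radius_def)
qed

text \<open>The surplus of the derivative over \<open>c\<close> is spent on shrinking the disc. The
  image of the smaller closed disc is a compact subset of \<open>outer p\<close>, so it survives a
  small increase of the level.\<close>

lemma admits_radius_open:
  assumes p: "0 < p" "p < 1" and c: "0 < c" "c < cmod (deriv F 0)"
    and F: "F holomorphic_on ball 0 1" "F 0 = 0" "F ` ball 0 1 \<subseteq> outer p"
  obtains q where "p < q" "q < 1" "admits_radius (outer q) c"
proof -
  \<comment> \<open>With this factor the derivative of z -> F(l z) at 0 has modulus exactly
    \<open>c\<close>.\<close>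
  define l where "l = c / cmod (deriv F 0)"
  have l: "0 < l" "l < 1" using c by (auto simp: l_def divide_simps split: if_splits)
  define L where "L = F ` cball 0 l"
  have lb: "cball 0 l \<subseteq> ball (0::complex) 1" using l by auto
  have cL: "compact L" unfolding L_def
    by (intro compact_continuous_image continuous_on_subset[OF holomorphic_on_imp_continuous_on[OF F(1)] lb]) auto
  have Lp: "L \<subseteq> outer p" using F(3) lb unfolding L_def by blast
  define q1 where "q1 = (p + 1) / 2"
  have q1: "p < q1" "q1 < 1" using p by (auto simp: q1_def)
  \<comment> \<open>The points of the larger disc that keep \<open>L\<close> from lying in the
    larger exteriors. They form a compact set outside radius \<open>p\<close>, so their least
    modulus leaves a gap for \<open>q\<close>.\<close>
  define M where "M = cball 0 q1 \<inter> f -` (- inverted_complement L)"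
  have "closed M" unfolding M_def
    by (intro continuous_closed_preimage cont q1 closed_Compl open_inverted_complement cL) auto
  hence cM: "compact M" unfolding M_def by (metis compact_Int_closed compact_cball compact_eq_bounded_closed bounded_Int bounded_cball)
  have Mp: "p < cmod y" if "y \<in> M" for y
  proof (rule ccontr)
    assume "\<not> ?thesis"
    moreover have "f y \<noteq> 0" "inverse (f y) \<in> L" using that by (auto simp: M_def inverted_complement_def)
    moreover have "inverse (f y) \<in> outer p" using Lp calculation by blast
    ultimately show False by (auto simp: inverted_complement_def)
  qed
  obtain q where q: "p < q" "q \<le> q1" "\<And>y. y \<in> M \<Longrightarrow> q < cmod y"
  proof (cases "M = {}")
    case True
    thus ?thesis using that[of q1] q1 by auto
  next
    case False
    obtain m where m: "m \<in> M" "\<And>y. y \<in> M \<Longrightarrow> cmod m \<le> cmod y"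
      using continuous_attains_inf[OF cM False continuous_on_norm_id] by auto
    obtain q where "p < q" "q < cmod m" using Mp[OF m(1)] dense by blast
    moreover have "cmod m \<le> q1" using m(1) by (auto simp: M_def)
    ultimately show ?thesis using m(2) by (intro that[of q]) force+
  qed
  have Lq: "L \<subseteq> outer q"
  proof
    fix w assume w: "w \<in> L"
    show "w \<in> outer q"
    proof (rule ccontr)
      assume "w \<notin> outer q"
      then obtain y where y: "cmod y \<le> q" "inverse w = f y" "w \<noteq> 0"
        by (auto simp: inverted_complement_def)
      have "inverse (f y) = w" using y by (metis inverse_inverse_eq)
      hence "y \<in> M" using y q w unfolding M_def inverted_complement_def by auto
      thus False using q(3) y(1) by fastforce
    qed
  qed
  have lz: "of_real l * z \<in> cball 0 l" if "z \<in> ball 0 1" for z :: complex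
    using that l mult_left_le[of "cmod z" l] by (simp add: norm_mult)
  let ?G = "\<lambda>z. F (of_real l * z)"
  have "?G holomorphic_on ball 0 1"
    by (rule holomorphic_on_compose_gen[OF _ F(1), unfolded o_def])
       (use lz lb in \<open>auto intro!: holomorphic_intros\<close>)
  moreover have "?G ` ball 0 1 \<subseteq> outer q" using lz Lq unfolding L_def by blast
  moreover have "deriv ?G 0 = deriv F 0 * of_real l"
  proof -
    have "(F has_field_derivative deriv F 0) (at (of_real l * 0))"
      using holomorphic_on_imp_differentiable_at[OF F(1), of 0]
      by (simp add: DERIV_deriv_iff_field_differentiable)
    hence "(?G has_field_derivative deriv F 0 * of_real l) (at 0)"
      by (rule DERIV_chain2) (auto intro!: derivative_eq_intros)
    thus ?thesis by (rule DERIV_imp_deriv)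
  qed
  moreover have "cmod (deriv F 0 * of_real l) = c" 
    unfolding norm_mult norm_of_real using c l by (cases "deriv F 0 = 0") (simp_all add: l_def)
  ultimately have "admits_radius (outer q) c"
    unfolding admits_radius_def using F(2) by (intro exI[of _ ?G]) auto
  with q q1 that show thesis by force
qed

end

subsection \<open>The Loewner step\<close>

lemma classS_univalent_disc: "classS f \<Longrightarrow> univalent_disc f"
  by unfold_locales (auto simp: classS_def classA_def)

text \<open>The domains \<open>k.outer q\<close> below are bounded by the level curves of the exterior Riemann map
  of \<open>f ` cball 0 r\<close>. As \<open>q\<close> decreases from \<open>1\<close> to \<open>0\<close> their conformal radii increase
  continuously from \<open>r\<close> to \<open>\<infinity>\<close>, so every \<open>c > r\<close> is attained.\<close>

lemma loewner_step:
  assumes f: "classS f" and r: "0 < r" "r < 1" and c: "r < c"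
  obtains g \<phi> where "classS g" "\<phi> holomorphic_on ball 0 1" "\<And>z. z \<in> ball 0 1 \<Longrightarrow> \<phi> z \<in> ball 0 1"
    "\<phi> 0 = 0" "\<And>z. z \<in> ball 0 1 \<Longrightarrow> f (of_real r * z) = of_real c * g (\<phi> z)"
proof -
  interpret f: univalent_disc f by (rule classS_univalent_disc[OF f])
  have df: "deriv f 0 = 1" using f by (simp add: classS_def classA_def)
  let ?K = "f ` cball 0 r"
  let ?U = "inverted_complement ?K"
  have K0: "0 \<in> ?K" using f.zero_interior[OF r] interior_subset by blast
  obtain k j d where k: "univalent_disc k" "k ` ball 0 1 = ?U" and "j holomorphic_on ?U"
    "j ` ?U \<subseteq> ball 0 1" "j 0 = 0" "\<And>w. w \<in> ?U \<Longrightarrow> k (j w) = w" "\<And>z. z \<in> ball 0 1 \<Longrightarrow> j (k z) = z"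
    "d > 0" "deriv k 0 = of_real d"
    by (rule f.riemann_map_inverted_complement[OF r]; rule that; assumption)
  interpret k: univalent_disc k by (rule k)
  have c0: "c > 0" using r c by simp
  define P where "P = {q. 0 < q \<and> q < 1 \<and> admits_radius (k.outer q) c}"
  obtain q0 where q0: "q0 \<in> P" using k.admits_radius_small[OF c0] by (auto simp: P_def)
  define p where "p = Sup P"
  have bdd: "bdd_above P" by (rule bdd_aboveI[of _ 1]) (auto simp: P_def)
  have p0: "0 < p" using cSup_upper[OF q0 bdd] q0 by (auto simp: P_def p_def)
  have p1: "p \<le> 1" unfolding p_def by (rule cSup_least) (use q0 in \<open>auto simp: P_def\<close>)
  have ex: "\<exists>q. s < q \<and> q < 1 \<and> admits_radius (k.outer q) c" if "s < p" for s
    using less_cSupE[of s P] that q0 unfolding p_def P_def by blast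
  \<comment> \<open>At level 1 the limit map would take values in \<open>?K\<close>. Pulled back by
    the inverse of \<open>f\<close> and divided by \<open>r\<close>, it is bounded by one with a
    derivative at 0 of modulus at least c/r > 1, against Schwarz-Pick.\<close>
  have "p \<noteq> 1"
  proof
    assume p: "p = 1"
    obtain F where F: "F holomorphic_on ball 0 1" "F 0 = 0" "c \<le> cmod (deriv F 0)"
      "\<And>z. z \<in> ball 0 1 \<Longrightarrow> F z = 0 \<or> inverse (F z) \<notin> k ` ball 0 p"
      using k.admits_radius_limit[OF p0 p1 c0 ex] by blast
    have FK: "F z \<in> ?K" if "z \<in> ball 0 1" for z
      using F(4)[OF that] K0 unfolding p k(2) by (auto simp: inverted_complement_def)
    obtain h where h: "h holomorphic_on f ` ball 0 1"
        "\<And>z. z \<in> ball 0 1 \<Longrightarrow> deriv f z * deriv h (f z) = 1" "\<And>z. z \<in> ball 0 1 \<Longrightarrow> h (f z) = z"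
      using holomorphic_has_inverse[OF f.hol open_ball f.inj] by blast
    have KD: "?K \<subseteq> f ` ball 0 1" using f.cball_subset[OF r(2)] by (intro image_mono) auto
    have hF: "(\<lambda>z. h (F z)) holomorphic_on ball 0 1"
      by (rule holomorphic_on_compose_gen[OF F(1) h(1), unfolded o_def]) (use FK KD in blast)
    have hle: "cmod (h (F z)) \<le> r" if "z \<in> ball 0 1" for z
    proof -
      obtain y where y: "y \<in> cball 0 r" "F z = f y" using FK[OF \<open>z \<in> ball 0 1\<close>] by blast
      thus ?thesis using h(3)[of y] r by auto
    qed
    have "deriv (\<lambda>z. h (F z) / of_real r) 0 = deriv F 0 / of_real r"
    proof -
      have "open (f ` ball 0 1)" by (rule f.open_image) simp
      moreover have "0 \<in> f ` ball 0 1" using f.zero by (intro image_eqI[of _ _ 0]) auto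
      ultimately have "(h has_field_derivative deriv h 0) (at (F 0))"
        using holomorphic_on_imp_differentiable_at[OF h(1)] F(2)
        by (simp add: DERIV_deriv_iff_field_differentiable)
      moreover have "(F has_field_derivative deriv F 0) (at 0)"
        using holomorphic_on_imp_differentiable_at[OF F(1)]
        by (simp add: DERIV_deriv_iff_field_differentiable)
      ultimately have "((\<lambda>z. h (F z)) has_field_derivative deriv h 0 * deriv F 0) (at 0)"
        by (rule DERIV_chain2)
      moreover have "deriv h 0 = 1" using h(2)[of 0] f.zero df by simp
      ultimately have "((\<lambda>z. h (F z) / of_real r) has_field_derivative deriv F 0 / of_real r) (at 0)"
        by (intro DERIV_cdivide) simp
      thus ?thesis by (rule DERIV_imp_deriv)
    qed
    moreover
    have "cmod (deriv (\<lambda>z. h (F z) / of_real r) 0) \<le> 1 - (cmod (h (F 0) / of_real r))\<^sup>2"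
      by (rule schwarz_pick_zero)
         (use hF hle r in \<open>auto intro!: holomorphic_intros simp: norm_divide divide_simps\<close>)
    hence "cmod (deriv (\<lambda>z. h (F z) / of_real r) 0) \<le> 1"
      using zero_le_power2[of "cmod (h (F 0) / of_real r)"] by linarith
    ultimately have "cmod (deriv F 0) / r \<le> 1" using r by (simp add: norm_divide)
    hence "cmod (deriv F 0) \<le> r" using r by (simp add: divide_simps)
    thus False using F(3) c by simp
  qed
  hence p1: "p < 1" using p1 by simp
  have adm: "admits_radius (k.outer p) c" by (rule k.admits_radius_closed[OF p0 p1 c0 ex])
  let ?H = "k.outer p"
  obtain F G d where F: "univalent_disc F" "F ` ball 0 1 = ?H" and G: "G holomorphic_on ?H"
    "G ` ?H \<subseteq> ball 0 1" "G 0 = 0" "\<And>w. w \<in> ?H \<Longrightarrow> F (G w) = w" and GF: "\<And>z. z \<in> ball 0 1 \<Longrightarrow> G (F z) = z"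
    and d: "d > 0" "deriv F 0 = of_real d"
    by (rule k.riemann_map_inverted_complement[OF p0 p1]; rule that; assumption)
  interpret F: univalent_disc F by (rule F)
  \<comment> \<open>A competitor \<open>E\<close> followed by the inverse \<open>G\<close> of the
    Riemann map is a self-map of the disc fixing 0, so by the Schwarz lemma the Riemann map has the
    largest derivative.\<close>
  have "c \<le> d"
  proof -
    obtain E where E: "E holomorphic_on ball 0 1" "E 0 = 0" "E ` ball 0 1 \<subseteq> ?H" "c \<le> cmod (deriv E 0)"
      using adm by (auto simp: admits_radius_def)
    have "(\<lambda>z. G (E z)) holomorphic_on ball 0 1"
      by (rule holomorphic_on_compose_gen[OF E(1) G(1) E(3), unfolded o_def])
    moreover have "cmod (G (E z)) < 1" if "cmod z < 1" for z
      using E(3) G(2) that by (metis image_subset_iff mem_ball_0)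
    ultimately have "cmod (deriv (\<lambda>z. G (E z)) 0) \<le> 1"
      using G(3) E(2) Schwarz_Lemma(2)[of "\<lambda>z. G (E z)" 0] by simp
    moreover have "(F has_field_derivative of_real d) (at (G (E 0)))"
      using holomorphic_on_imp_differentiable_at[OF F.hol, of 0] d(2) G(3) E(2)
      by (simp flip: d(2) add: DERIV_deriv_iff_field_differentiable)
    moreover have "((\<lambda>z. G (E z)) has_field_derivative deriv (\<lambda>z. G (E z)) 0) (at 0)"
      using holomorphic_on_imp_differentiable_at[OF \<open>(\<lambda>z. G (E z)) holomorphic_on ball 0 1\<close>, of 0]
      by (simp add: DERIV_deriv_iff_field_differentiable)
    ultimately have "((\<lambda>z. F (G (E z))) has_field_derivative of_real d * deriv (\<lambda>z. G (E z)) 0) (at 0)"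
      and le: "cmod (deriv (\<lambda>z. G (E z)) 0) \<le> 1"
      by (auto intro: DERIV_chain2)
    hence "deriv (\<lambda>z. F (G (E z))) 0 = of_real d * deriv (\<lambda>z. G (E z)) 0"
      by (intro DERIV_imp_deriv)
    moreover have "deriv (\<lambda>z. F (G (E z))) 0 = deriv E 0"
    proof (intro deriv_cong_ev eventually_ball_at_0 refl)
      show "F (G (E z)) = E z" if "z \<in> ball 0 1" for z using G(4)[of "E z"] E(3) that by blast
    qed
    ultimately have "c \<le> d * cmod (deriv (\<lambda>z. G (E z)) 0)"
      using E(4) d(1) by (simp add: norm_mult)
    also have "\<dots> \<le> d * 1" using le d(1) by (intro mult_left_mono) auto
    finally show ?thesis by simp
  qed
  \<comment> \<open>A strictly larger radius would persist beyond the supremum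
    \<open>p\<close>.\<close>
  moreover have "\<not> c < d"
  proof
    assume "c < d"
    then obtain q where q: "p < q" "q < 1" "admits_radius (k.outer q) c"
      using k.admits_radius_open[OF p0 p1 c0 _ F.hol F.zero] F(2) d by auto
    hence "q \<in> P" using p0 by (simp add: P_def)
    thus False using cSup_upper[OF _ bdd] q(1) unfolding p_def by fastforce
  qed
  ultimately have dc: "deriv F 0 = of_real c" using d(2) by simp
  \<comment> \<open>Nonzero values of \<open>k\<close> are reciprocals of points outside
    \<open>?K\<close>, hence \<open>?K\<close> is contained in \<open>?H\<close>.\<close>
  have fH: "f (of_real r * z) \<in> ?H" if "z \<in> ball 0 1" for z
  proof -
    have "of_real r * z \<in> cball 0 r" using that r mult_left_le[of "cmod z" r] by (simp add: norm_mult)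
    hence w: "f (of_real r * z) \<in> ?K" by blast
    have "inverse w \<notin> k ` cball 0 p" if "w \<in> ?K" "w \<noteq> 0" for w
    proof
      assume "inverse w \<in> k ` cball 0 p"
      hence "inverse w \<in> ?U" using k(2) k.cball_subset[OF p1] by blast
      thus False using that by (auto simp: inverted_complement_def)
    qed
    with w show ?thesis by (auto simp: inverted_complement_def)
  qed
  show thesis
  proof (rule that[of "\<lambda>z. F z / of_real c" "\<lambda>z. G (f (of_real r * z))"])
    have "((\<lambda>z. F z / of_real c) has_field_derivative deriv F 0 / of_real c) (at 0)"
      using holomorphic_on_imp_differentiable_at[OF F.hol, of 0]
      by (intro DERIV_cdivide) (simp add: DERIV_deriv_iff_field_differentiable)
    hence "deriv (\<lambda>z. F z / of_real c) 0 = 1" using dc c0 DERIV_imp_deriv by fastforce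
    thus "classS (\<lambda>z. F z / of_real c)"
      using F.hol F.zero F.inj c0
      by (auto simp: classS_def classA_def inj_on_def intro!: holomorphic_intros)
    have "(\<lambda>z. f (of_real r * z)) holomorphic_on ball 0 1"
    proof (rule holomorphic_on_compose_gen[OF _ f.hol, unfolded o_def])
      show "(*) (of_real r) ` ball 0 1 \<subseteq> ball (0::complex) 1"
        using norm_mult_less[of "of_real r :: complex" 1 _ 1] r by auto
    qed (auto intro!: holomorphic_intros)
    thus "(\<lambda>z. G (f (of_real r * z))) holomorphic_on ball 0 1"
      by (rule holomorphic_on_compose_gen[OF _ G(1), unfolded o_def]) (use fH in blast)
    show "G (f (of_real r * z)) \<in> ball 0 1" if "z \<in> ball 0 1" for z
      using fH[OF that] G(2) by blast
    show "G (f (of_real r * 0)) = 0" using f.zero G(3) by simp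
    show "f (of_real r * z) = of_real c * (F (G (f (of_real r * z))) / of_real c)" if "z \<in> ball 0 1" for z
      using G(4)[OF fH[OF that]] c0 by simp
  qed
qed

section \<open>Coefficient relations from the Loewner step\<close>

text \<open>Serves both limits of the supremum arguments: first r -> 1 at fixed \<sigma>, then
  \<sigma> -> 1.\<close>

lemma le_at_one_of_le_left:
  fixes u v :: "real \<Rightarrow> real"
  assumes "isCont u 1" "isCont v 1" "\<And>t. 1/2 < t \<Longrightarrow> t < 1 \<Longrightarrow> u t \<le> v t"
  shows "u 1 \<le> v 1"
proof (rule tendsto_le[of "at_left (1::real)"])
  show "(v \<longlongrightarrow> v 1) (at_left 1)" "(u \<longlongrightarrow> u 1) (at_left 1)"
    using assms by (auto simp: isCont_def intro: tendsto_within_subset)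
  have "\<forall>\<^sub>F t in at_left (1::real). t \<in> {1/2<..<1}" by (rule eventually_at_left_real) simp
  thus "\<forall>\<^sub>F t in at_left 1. u t \<le> v t" by eventually_elim (use assms(3) in auto)
qed simp

text \<open>For \<open>f\<close> with f(0) = 0 and f'(0) = 1 this is -1/6 times the Schwarzian
  derivative at 0, and also the coefficient of 1/z in the expansion of 1/f(1/z) at infinity.\<close>

definition second_invariant :: "(complex \<Rightarrow> complex) \<Rightarrow> complex" where
  "second_invariant f = (taylor_coeff f 2)\<^sup>2 - taylor_coeff f 3"

lemma taylor_coeff_scale:
  assumes "f holomorphic_on ball 0 1"
  shows "taylor_coeff (\<lambda>z. a * f (c * z)) n = a * c ^ n * taylor_coeff f n"
proof -
  have "(\<lambda>z. c * z) has_fps_expansion fps_const c * fps_X"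
    by (intro fps_expansion_intros)
  hence "(f \<circ> (\<lambda>z. c * z)) has_fps_expansion (Abs_fps (taylor_coeff f) oo (fps_const c * fps_X))"
    by (intro has_fps_expansion_compose has_fps_expansion_taylor assms) auto
  hence "(\<lambda>z. f (c * z)) has_fps_expansion Abs_fps (\<lambda>n. c ^ n * taylor_coeff f n)"
    by (simp add: o_def fps_compose_linear)
  hence "(\<lambda>z. a * f (c * z)) has_fps_expansion fps_const a * Abs_fps (\<lambda>n. c ^ n * taylor_coeff f n)"
    by (intro fps_expansion_intros)
  from taylor_coeff_eq_fps_nth[OF this] show ?thesis by simp
qed

lemma taylor_coeff_compose:
  assumes g: "g holomorphic_on ball 0 1" and phi: "\<phi> holomorphic_on ball 0 1" "\<phi> 0 = 0"
    and eq: "\<And>z. z \<in> ball 0 1 \<Longrightarrow> h z = g (\<phi> z)"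
  shows "taylor_coeff h (Suc 0) = taylor_coeff g (Suc 0) * taylor_coeff \<phi> (Suc 0)"
    "taylor_coeff h 2 = taylor_coeff g (Suc 0) * taylor_coeff \<phi> 2 + taylor_coeff g 2 * taylor_coeff \<phi> (Suc 0) ^ 2"
    "taylor_coeff h 3 = taylor_coeff g (Suc 0) * taylor_coeff \<phi> 3
       + 2 * taylor_coeff g 2 * taylor_coeff \<phi> (Suc 0) * taylor_coeff \<phi> 2 + taylor_coeff g 3 * taylor_coeff \<phi> (Suc 0) ^ 3"
proof -
  let ?G = "Abs_fps (taylor_coeff g)" and ?P = "Abs_fps (taylor_coeff \<phi>)"
  have P0: "taylor_coeff \<phi> 0 = 0" using phi by (simp add: taylor_coeff_0_1)
  have "(g \<circ> \<phi>) has_fps_expansion (?G oo ?P)"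
    by (intro has_fps_expansion_compose has_fps_expansion_taylor g phi) (simp add: P0)
  hence "h has_fps_expansion (?G oo ?P)"
    by (rule has_fps_expansion_cong[THEN iffD1, rotated -1])
       (auto intro!: eventually_ball_at_0 simp: eq)
  note * = taylor_coeff_eq_fps_nth[OF this]
  show "taylor_coeff h (Suc 0) = taylor_coeff g (Suc 0) * taylor_coeff \<phi> (Suc 0)"
    unfolding * by (simp add: fps_compose_nth P0)
  show "taylor_coeff h 2 = taylor_coeff g (Suc 0) * taylor_coeff \<phi> 2 + taylor_coeff g 2 * taylor_coeff \<phi> (Suc 0) ^ 2"
    unfolding * by (simp add: fps_compose_nth eval_nat_numeral fps_mult_nth P0)
  show "taylor_coeff h 3 = taylor_coeff g (Suc 0) * taylor_coeff \<phi> 3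
       + 2 * taylor_coeff g 2 * taylor_coeff \<phi> (Suc 0) * taylor_coeff \<phi> 2 + taylor_coeff g 3 * taylor_coeff \<phi> (Suc 0) ^ 3"
    unfolding * by (simp add: fps_compose_nth eval_nat_numeral fps_mult_nth P0 algebra_simps)
qed

text \<open>Coefficient comparison in f(r z) = (r/\<sigma>) g(\<phi>(z)). In the second invariant
  the cross term between \<open>taylor_coeff g 2\<close> and \<open>p\<close> cancels, so each
  relation involves a single invariant of \<open>g\<close>.\<close>

lemma loewner_coefficients:
  fixes r \<sigma> :: real
  assumes f: "classS f" and r: "0 < r" "r < 1" and sig: "0 < \<sigma>" "\<sigma> < 1"
  obtains g and p q :: complex where "classS g" "cmod p \<le> 1" "cmod q \<le> 1 - (cmod p)\<^sup>2"
    "of_real r * taylor_coeff f 2 = \<sigma> * taylor_coeff g 2 + (1 - \<sigma>\<^sup>2) / \<sigma> * p"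
    "of_real (r\<^sup>2) * second_invariant f =
       \<sigma>\<^sup>2 * second_invariant g + (1 - \<sigma>\<^sup>2) / \<sigma>\<^sup>2 * (p\<^sup>2 - \<sigma> * q)"
proof -
  let ?s = "complex_of_real \<sigma>" and ?r = "complex_of_real r"
  \<comment> \<open>The radius r/\<sigma> forces \<open>deriv \<phi> 0\<close> to be \<sigma>, since
    \<open>f\<close> and \<open>g\<close> both have derivative 1 at 0.\<close>
  have rc: "r < r / \<sigma>" using r sig by (simp add: divide_simps)
  obtain g \<phi> where g: "classS g" "\<phi> holomorphic_on ball 0 1" "\<And>z. z \<in> ball 0 1 \<Longrightarrow> \<phi> z \<in> ball 0 1"
    "\<phi> 0 = 0" "\<And>z. z \<in> ball 0 1 \<Longrightarrow> f (of_real r * z) = of_real (r / \<sigma>) * g (\<phi> z)"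
    by (rule loewner_step[OF f r rc]; rule that; assumption)
  have hol: "f holomorphic_on ball 0 1" "g holomorphic_on ball 0 1"
    and f1: "taylor_coeff f (Suc 0) = 1" "taylor_coeff g (Suc 0) = 1"
    using f g(1) by (auto simp: classS_def classA_def taylor_coeff_0_1)
  have s0: "?s \<noteq> 0" and r0: "?r \<noteq> 0" using sig r by auto
  have h: "(?s / ?r) * f (?r * z) = g (\<phi> z)" if "z \<in> ball 0 1" for z
    using g(5)[OF that] s0 r0 by simp
  note sc = taylor_coeff_scale[OF hol(1), of "?s / ?r" ?r]
  note tc = taylor_coeff_compose[of g \<phi> "\<lambda>z. (?s / ?r) * f (?r * z)", OF hol(2) g(2) g(4) h, unfolded sc f1]
  have p1: "taylor_coeff \<phi> (Suc 0) = ?s" using tc(1) r0 by simp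
  hence d: "deriv \<phi> 0 = ?s" by (simp add: taylor_coeff_0_1)
  obtain p q where pq: "cmod p \<le> 1" "cmod q \<le> 1 - (cmod p)\<^sup>2"
    "taylor_coeff \<phi> 2 = of_real (1 - \<sigma>\<^sup>2) * p"
    "taylor_coeff \<phi> 3 = of_real (1 - \<sigma>\<^sup>2) * (q - of_real \<sigma> * p\<^sup>2)"
    
    by (rule schur_coefficients[OF g(2) _ g(4) d sig]; ((rule g(3), assumption) | (rule that; assumption)))
  define D where "D = 1 - ?s\<^sup>2"
  have D: "complex_of_real (1 - \<sigma>\<^sup>2) = D" by (simp add: D_def)
  have a2: "?r * taylor_coeff f 2 = ?s * taylor_coeff g 2 + D / ?s * p"
  proof -
    have "?s * (?r * taylor_coeff f 2) = D * p + taylor_coeff g 2 * ?s\<^sup>2"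
      using tc(2) r0 unfolding p1 pq(3) D by (simp add: power2_eq_square mult.assoc)
    thus ?thesis using s0 by (simp add: field_simps power2_eq_square)
  qed
  have a3: "?r\<^sup>2 * taylor_coeff f 3 = D / ?s * (q - ?s * p\<^sup>2) + 2 * taylor_coeff g 2 * (D * p) + ?s\<^sup>2 * taylor_coeff g 3"
  proof -
    have "?s * (?r\<^sup>2 * taylor_coeff f 3) = D * (q - ?s * p\<^sup>2) + 2 * taylor_coeff g 2 * ?s * (D * p) + taylor_coeff g 3 * ?s ^ 3"
      using tc(3) r0 unfolding p1 pq(3,4) D by (simp add: power2_eq_square power3_eq_cube mult.assoc)
    thus ?thesis using s0 by (simp add: field_simps power2_eq_square power3_eq_cube)
  qed
  have "?r\<^sup>2 * second_invariant f = (?r * taylor_coeff f 2)\<^sup>2 - ?r\<^sup>2 * taylor_coeff f 3"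
    by (simp add: second_invariant_def algebra_simps power2_eq_square)
  also have "\<dots> = ?s\<^sup>2 * second_invariant g + D / ?s\<^sup>2 * ((D + ?s\<^sup>2) * p\<^sup>2 - ?s * q)"
    unfolding a2 a3 second_invariant_def using s0 by (simp add: field_simps power2_eq_square)
  also have "D + ?s\<^sup>2 = 1" by (simp add: D_def)
  finally have b: "?r\<^sup>2 * second_invariant f = ?s\<^sup>2 * second_invariant g + D / ?s\<^sup>2 * (p\<^sup>2 - ?s * q)" by simp
  show thesis
    by (rule that[OF g(1) pq(1,2)]) (use a2 b in \<open>simp_all add: D_def\<close>)
qed

text \<open>Up to an error quadratic in \<open>1 - \<sigma>\<close>, the excess of
  \<open>(Re a)\<^sup>2 - s Re b\<close> over \<open>4 - s\<close> contracts by the factor \<open>\<sigma>\<close>,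
  provided that the parameter \<open>s\<close> is replaced by \<open>s \<sigma>\<close>. Allowing \<open>s\<close> to vary is
  what closes the supremum argument.\<close>

lemma loewner_step_inequality:
  fixes A B p q :: complex and \<sigma> s :: real
  assumes sig: "1/2 \<le> \<sigma>" "\<sigma> < 1" and s: "0 \<le> s" "s \<le> 1"
    and p: "cmod p \<le> 1" and q: "cmod q \<le> 1 - (cmod p)\<^sup>2"
    and a: "a = \<sigma> * A + (1 - \<sigma>\<^sup>2) / \<sigma> * p"
    and b: "b = \<sigma>\<^sup>2 * B + (1 - \<sigma>\<^sup>2) / \<sigma>\<^sup>2 * (p\<^sup>2 - \<sigma> * q)"
  shows "(Re a)\<^sup>2 - s * Re b + s - 4 \<le>
      \<sigma> * ((Re A)\<^sup>2 - s * \<sigma> * Re B + s * \<sigma> - 4) + 40 * (1 - \<sigma>)\<^sup>2"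
proof -
  \<comment> \<open>The factors (1 - \<sigma>^2)/\<sigma> and (1 - \<sigma>^2)/\<sigma>^2 equal
    \<open>e * g\<close> and \<open>e * h\<close>, with \<open>g\<close> and \<open>h\<close> close
    to 2.\<close>
  define e x y g h where "e = 1 - \<sigma>" and "x = Re p" and "y = Im p"
    and "g = (1 + \<sigma>) / \<sigma>" and "h = (1 + \<sigma>) / \<sigma>\<^sup>2"
  have e: "0 < e" "e \<le> 1/2" "\<sigma> = 1 - e" using sig by (auto simp: e_def)
  have cp: "(cmod p)\<^sup>2 = x\<^sup>2 + y\<^sup>2" by (simp add: cmod_power2 x_def y_def)
  have xy: "x\<^sup>2 + y\<^sup>2 \<le> 1" using p cp by (metis abs_norm_cancel abs_square_le_1)
  hence x1: "x\<^sup>2 \<le> 1" and y1: "y\<^sup>2 \<le> 1" by (smt (verit) zero_le_power2)+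
  have Rq: "\<bar>Re q\<bar> \<le> 1 - x\<^sup>2 - y\<^sup>2" using q cp abs_Re_le_cmod[of q] by linarith
  have Rp: "Re (p\<^sup>2) = x\<^sup>2 - y\<^sup>2" by (simp add: power2_eq_square x_def y_def)
  have Ra: "Re a = \<sigma> * Re A + e * (g * x)"
  proof -
    have "a = of_real \<sigma> * A + of_real ((1 - \<sigma>\<^sup>2) / \<sigma>) * p" using a by simp
    hence "Re a = \<sigma> * Re A + (1 - \<sigma>\<^sup>2) / \<sigma> * x" by (simp only: x_def) simp
    also have "(1 - \<sigma>\<^sup>2) / \<sigma> = e * g" by (simp add: e_def g_def power2_eq_square algebra_simps)
    finally show ?thesis by simp
  qed
  have Rb: "Re b = \<sigma>\<^sup>2 * Re B + e * h * (x\<^sup>2 - y\<^sup>2 - \<sigma> * Re q)"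
  proof -
    have "b = of_real (\<sigma>\<^sup>2) * B + of_real ((1 - \<sigma>\<^sup>2) / \<sigma>\<^sup>2) * (p\<^sup>2 - of_real \<sigma> * q)" using b by simp
    hence "Re b = \<sigma>\<^sup>2 * Re B + (1 - \<sigma>\<^sup>2) / \<sigma>\<^sup>2 * (Re (p\<^sup>2) - \<sigma> * Re q)" by (simp only:) simp
    also have "(1 - \<sigma>\<^sup>2) / \<sigma>\<^sup>2 = e * h"
      by (simp add: e_def h_def) (simp add: power2_eq_square algebra_simps)
    finally show ?thesis by (simp add: Rp)
  qed
  \<comment> \<open>Convexity of the square with weights \<sigma> and 1 - \<sigma> removes the cross
    term between \<open>Re A\<close> and \<open>x\<close>.\<close>
  have "(1 - e) * (u)\<^sup>2 + e * v\<^sup>2 - ((1 - e) * u + e * v)\<^sup>2 = e * (1 - e) * (u - v)\<^sup>2" for u v :: real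
    by algebra
  moreover have "0 \<le> e * (1 - e) * (u - v)\<^sup>2" for u v :: real using e by simp
  ultimately have cvx: "((1 - e) * u + e * v)\<^sup>2 \<le> (1 - e) * u\<^sup>2 + e * v\<^sup>2" for u v :: real
    by (smt (verit))
  have g: "0 \<le> g" "g \<le> 2 + 2 * e"
  proof -
    have "0 \<le> e * (1 - 2 * e)" using e by simp
    hence "1 + \<sigma> \<le> (2 + 2 * e) * \<sigma>" unfolding e(3) by (simp add: algebra_simps)
    thus "g \<le> 2 + 2 * e" using sig by (simp add: g_def divide_simps)
  qed (use sig in \<open>simp add: g_def\<close>)
  have "g\<^sup>2 \<le> (2 + 2 * e)\<^sup>2" using g by (intro power_mono) auto
  also have "\<dots> \<le> 4 + 12 * e" using e mult_left_mono[of e 1 e] by (simp add: power2_eq_square algebra_simps)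
  finally have g2: "g\<^sup>2 \<le> 4 + 12 * e" .
  have "(g * x)\<^sup>2 \<le> (4 + 12 * e) * x\<^sup>2" unfolding power_mult_distrib by (intro mult_right_mono g2) auto
  also have "\<dots> \<le> 4 * x\<^sup>2 + 12 * e" using x1 e mult_left_mono[OF x1, of "12 * e"] by (simp add: algebra_simps)
  finally have gx: "(g * x)\<^sup>2 \<le> 4 * x\<^sup>2 + 12 * e" .
  have Ra2: "(Re a)\<^sup>2 \<le> \<sigma> * (Re A)\<^sup>2 + e * (4 * x\<^sup>2 + 12 * e)"
    proof -
    have "e * (g * x)\<^sup>2 \<le> e * (4 * x\<^sup>2 + 12 * e)" using e gx by (intro mult_left_mono) auto
    thus ?thesis using cvx[of "Re A" "g * x"] unfolding Ra e(3) by linarith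
  qed
  define k where "k = - (x\<^sup>2 - y\<^sup>2 - \<sigma> * Re q)"
  have k: "k \<le> (1 - e) * (1 - 2 * x\<^sup>2) + e"
  proof -
    have "\<sigma> * Re q \<le> \<sigma> * (1 - x\<^sup>2 - y\<^sup>2)" using Rq sig by (intro mult_left_mono) auto
    moreover have "e * y\<^sup>2 \<le> e * 1" using y1 e by (intro mult_left_mono) auto
    moreover have "0 \<le> e * x\<^sup>2" using e by simp
    ultimately show ?thesis unfolding k_def e(3) by (simp add: algebra_simps)
  qed
  have k2: "k \<le> 2"
  proof -
    have "\<sigma> * Re q \<le> \<sigma> * \<bar>Re q\<bar>" using sig by (intro mult_left_mono) auto
    also have "\<dots> \<le> 1 * \<bar>Re q\<bar>" using sig by (intro mult_right_mono) auto
    finally show ?thesis using Rq zero_le_power2[of x] unfolding k_def by linarith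
  qed
  have h: "2 \<le> h" "h \<le> 2 + 12 * e"
  proof -
    have "\<sigma>\<^sup>2 \<le> \<sigma>" using sig by (simp add: power2_eq_square)
    moreover have "\<sigma>\<^sup>2 \<le> 1" using sig by (simp add: power_le_one)
    ultimately show "2 \<le> h" using sig by (simp add: h_def divide_simps)
    have "0 \<le> e * ((\<sigma> - 1/2) * (12 * \<sigma> + 4))" using e sig by (intro mult_nonneg_nonneg) auto
    have "(2 + 12 * e) * \<sigma>\<^sup>2 - (1 + \<sigma>) = e * ((\<sigma> - 1/2) * (12 * \<sigma> + 4) + 1)"
      unfolding e(3) by algebra
    moreover have "0 \<le> e * ((\<sigma> - 1/2) * (12 * \<sigma> + 4) + 1)" using e \<open>0 \<le> e * ((\<sigma> - 1/2) * (12 * \<sigma> + 4))\<close> by (simp only: distrib_left)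
    ultimately have "1 + \<sigma> \<le> (2 + 12 * e) * \<sigma>\<^sup>2" by linarith
    thus "h \<le> 2 + 12 * e" using sig by (simp add: h_def divide_simps)
  qed
  \<comment> \<open>Replacing \<open>h\<close> by 2 costs at most 24 e, and the term in
    \<open>e * x\<^sup>2\<close> another 4 e.\<close>
  have "h * k = 2 * k + (h - 2) * k" by (simp add: algebra_simps)
  moreover have "(h - 2) * k \<le> (h - 2) * 2" using h k2 by (intro mult_left_mono) auto
  moreover have "e * x\<^sup>2 \<le> e * 1" using e x1 by (intro mult_left_mono) auto
  moreover have "k \<le> 1 - 2 * x\<^sup>2 + 2 * (e * x\<^sup>2)" using k by (simp add: algebra_simps)
  ultimately have hk: "h * k \<le> 2 * (1 - 2 * x\<^sup>2) + 28 * e" using h by argo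
  have "- s * Re b = - s * \<sigma>\<^sup>2 * Re B + s * (e * (h * k))" by (simp add: Rb k_def algebra_simps)
  also have "s * (e * (h * k)) \<le> s * (e * (2 * (1 - 2 * x\<^sup>2) + 28 * e))"
    using s e hk by (intro mult_left_mono) auto
  also have "s * (e * (2 * (1 - 2 * x\<^sup>2) + 28 * e)) = e * (s * (2 - 4 * x\<^sup>2)) + s * (28 * e\<^sup>2)"
    by (simp add: algebra_simps power2_eq_square)
  also have "s * (28 * e\<^sup>2) \<le> 1 * (28 * e\<^sup>2)" using s by (intro mult_right_mono) auto
  finally have Rb2: "- s * Re b \<le> - s * \<sigma>\<^sup>2 * Re B + (e * (s * (2 - 4 * x\<^sup>2)) + 28 * e\<^sup>2)" by simp
  \<comment> \<open>The right side minus the left is 4 (1 - s) (1 - x^2); this is where s \<le> 1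
    enters.\<close>
  have "4 * x\<^sup>2 + s * (2 - 4 * x\<^sup>2) \<le> 4 - 2 * s"
    using mult_nonneg_nonneg[of "1 - s" "1 - x\<^sup>2"] s x1 by (simp add: algebra_simps)
  hence m: "e * (4 * x\<^sup>2 + s * (2 - 4 * x\<^sup>2)) \<le> e * (4 - 2 * s)" using e by (intro mult_left_mono) auto
  \<comment> \<open>The errors 12 e^2 and 28 e^2 add up to the constant 40; passing from
    \<open>s\<close> to \<open>s * \<sigma>\<close> leaves the nonnegative remainder s e^2.\<close>
  have "0 \<le> s * e\<^sup>2" using s by simp
  moreover have "\<sigma> * ((Re A)\<^sup>2 - s * \<sigma> * Re B + s * \<sigma> - 4) + 40 * e\<^sup>2 - (\<sigma> * (Re A)\<^sup>2 + 12 * e\<^sup>2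
      - s * \<sigma>\<^sup>2 * Re B + e * (4 - 2 * s) + 28 * e\<^sup>2 + s - 4) = s * e\<^sup>2"
    unfolding e(3) by algebra
  moreover have "e * (4 * x\<^sup>2 + 12 * e) + e * (s * (2 - 4 * x\<^sup>2)) =
      e * (4 * x\<^sup>2 + s * (2 - 4 * x\<^sup>2)) + 12 * e\<^sup>2"
    by (simp add: algebra_simps power2_eq_square)
  ultimately show ?thesis using Ra2 Rb2 m unfolding e_def[symmetric] by linarith
qed

subsection \<open>Coefficient bounds\<close>

text \<open>A rotation can make a chosen coefficient real and nonnegative, which turns bounds on
  real parts into bounds on moduli.\<close>

lemma classS_rotate:
  assumes f: "classS f" and u: "cmod u = 1"
  shows "classS (\<lambda>z. inverse u * f (u * z))"
    "taylor_coeff (\<lambda>z. inverse u * f (u * z)) 2 = u * taylor_coeff f 2"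
    "taylor_coeff (\<lambda>z. inverse u * f (u * z)) 3 = u\<^sup>2 * taylor_coeff f 3"
proof -
  have u0: "u \<noteq> 0" using u by auto
  have hol: "f holomorphic_on ball 0 1" using f by (simp add: classS_def classA_def)
  have "(\<lambda>z. f (u * z)) holomorphic_on ball 0 1"
    by (rule holomorphic_on_compose_gen[OF _ hol, unfolded o_def])
       (use u in \<open>auto intro!: holomorphic_intros simp: norm_mult\<close>)
  hence h: "(\<lambda>z. inverse u * f (u * z)) holomorphic_on ball 0 1" by (intro holomorphic_intros)
  have "deriv (\<lambda>z. inverse u * f (u * z)) 0 = deriv f 0"
    using taylor_coeff_scale[OF hol, of "inverse u" u "Suc 0"] u0 by (simp add: taylor_coeff_0_1)
  moreover have "inj_on (\<lambda>z. inverse u * f (u * z)) (ball 0 1)"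
  proof (rule inj_onI)
    fix x y assume xy: "x \<in> ball 0 1" "y \<in> ball 0 1" "inverse u * f (u * x) = inverse u * f (u * y)"
    hence "f (u * x) = f (u * y)" using u0 by simp
    moreover have "u * x \<in> ball 0 1" "u * y \<in> ball 0 1" using xy u by (auto simp: norm_mult)
    moreover have "inj_on f (ball 0 1)" using f by (simp add: classS_def)
    ultimately have "u * x = u * y" by (metis inj_onD)
    thus "x = y" using u0 by simp
  qed
  ultimately show "classS (\<lambda>z. inverse u * f (u * z))"
    using f h by (simp add: classS_def classA_def)
  show "taylor_coeff (\<lambda>z. inverse u * f (u * z)) 2 = u * taylor_coeff f 2"
    "taylor_coeff (\<lambda>z. inverse u * f (u * z)) 3 = u\<^sup>2 * taylor_coeff f 3"
    using u0 by (simp_all add: taylor_coeff_scale[OF hol] power2_eq_square power3_eq_cube)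
qed

text \<open>The image of the disc of radius 1/2 omits two points \<open>w1\<close>,
  \<open>w2\<close> of controlled size and separation. An affine change of variable moves them to 0
  and 1, Schottky's theorem bounds \<open>f\<close> uniformly over the class on the disc of radius
  1/4, and Cauchy's inequality bounds the coefficients.\<close>

lemma taylor_coeff_bound:
  obtains B where "\<And>f n. classS f \<Longrightarrow> cmod (taylor_coeff f n) \<le> B * 4 ^ n"
proof -
  \<comment> \<open>Schottky's constant for value at most 1 at the centre and relative radius
    1/2.\<close>
  define C where "C = exp (pi * exp (pi * (2 + 2 * 1 + 12 * (1/2) / (1 - 1/2))))"
  have "cmod (taylor_coeff f n) \<le> (1 + 3 * C) * 4 ^ n" if f: "classS f" for f n
  proof -
    interpret f: univalent_disc f by (rule classS_univalent_disc[OF f])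
    have df: "deriv f 0 = 1" using f by (simp add: classS_def classA_def)
    let ?K = "f ` cball 0 (1/2)"
    have K: "compact ?K" by (rule f.compact_image) simp
    have cK: "connected (- ?K)"
      by (rule connected_compl_image_cball[OF f.cont f.inj_cball]) auto
    obtain w1 where w1: "w1 \<notin> ?K" "cmod w1 < 1"
    proof -
      have "\<not> ball 0 1 \<subseteq> ?K"
      proof
        \<comment> \<open>Otherwise the inverse \<open>h\<close> of \<open>f\<close> would map the
          unit disc into the disc of radius 1/2 with derivative 1 at 0, and \<open>2 * h\<close>
          would violate Schwarz-Pick.\<close>
        assume sub: "ball 0 1 \<subseteq> ?K"
        obtain h where h: "h holomorphic_on f ` ball 0 1"
          "\<And>z. z \<in> ball 0 1 \<Longrightarrow> deriv f z * deriv h (f z) = 1" "\<And>z. z \<in> ball 0 1 \<Longrightarrow> h (f z) = z"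
          using holomorphic_has_inverse[OF f.hol open_ball f.inj] by blast
        have "?K \<subseteq> f ` ball 0 1" by (intro image_mono) auto
        with sub have hh: "h holomorphic_on ball 0 1" using h(1) by (blast intro: holomorphic_on_subset)
        have le: "cmod (h w) \<le> 1/2" if "w \<in> ball 0 1" for w
        proof -
          have "w \<in> ?K" using sub that by (rule subsetD)
          then obtain y where "y \<in> cball 0 (1/2)" "w = f y" by blast
          thus ?thesis using h(3)[of y] by auto
        qed
        have d1: "deriv h 0 = 1" using h(2)[of 0] f.zero df by simp
        have "(h has_field_derivative 1) (at 0)"
          using holomorphic_on_imp_differentiable_at[OF hh, of 0] d1
          by (simp flip: d1 add: DERIV_deriv_iff_field_differentiable)
        hence "((\<lambda>z. 2 * h z) has_field_derivative 2 * 1) (at 0)" by (rule DERIV_cmult)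
        hence "deriv (\<lambda>z. 2 * h z) 0 = 2" by (simp add: DERIV_imp_deriv)
        moreover have "cmod (deriv (\<lambda>z. 2 * h z) 0) \<le> 1 - (cmod (2 * h 0))\<^sup>2"
          
        proof (rule schwarz_pick_zero)
          show "cmod (2 * h z) \<le> 1" if "z \<in> ball 0 1" for z
            using le[OF that] by (simp add: norm_mult)
        qed (intro holomorphic_intros hh)
        ultimately have "2 \<le> 1 - (cmod (2 * h 0))\<^sup>2" by simp
        thus False using zero_le_power2[of "cmod (2 * h 0)"] by linarith
      qed
      then obtain w where "w \<in> ball 0 1" "w \<notin> ?K" by blast
      thus thesis using that[of w] by simp
    qed
    obtain w2 where w2: "w2 \<notin> ?K" "cmod w2 = 2"
    proof -
      have "bounded (cball 0 2 \<union> ?K)" using K compact_imp_bounded by auto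
      hence "cball 0 2 \<union> ?K \<noteq> UNIV" using not_bounded_UNIV by (metis (no_types))
      then obtain x where x: "x \<notin> cball 0 2 \<union> ?K" by blast
      \<comment> \<open>The connected complement contains \<open>w1\<close> inside and
        \<open>x\<close> outside the circle of radius 2, so it meets that circle.\<close>
      have "- ?K \<inter> frontier (ball 0 2) \<noteq> {}"
        by (rule connected_Int_frontier[OF cK]) (use w1 x in force)+
      thus thesis using that by (auto simp: frontier_ball)
    qed
    have n1: "1 \<le> cmod (w2 - w1)" "cmod (w2 - w1) \<le> 3"
      using norm_triangle_ineq2[of w2 w1] norm_triangle_ineq4[of w2 w1] w1 w2 by linarith+
    hence ne: "w2 - w1 \<noteq> 0" by auto
    define g where "g z = (f (z / 2) - w1) / (w2 - w1)" for z
    have fh: "(\<lambda>z. f (z / 2)) holomorphic_on cball 0 1"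
      by (rule holomorphic_on_compose_gen[OF _ f.hol, unfolded o_def]) (auto intro!: holomorphic_intros)
    have gb: "cmod (g z) \<le> C" if "cmod z \<le> 1/2" for z
      unfolding C_def
    proof (rule Schottky[OF _ _ _ _ _ that])
      show "g holomorphic_on cball 0 1" unfolding g_def using ne fh by (intro holomorphic_intros) auto
      have "cmod (g 0) \<le> cmod w1 / cmod (w2 - w1)" by (simp add: g_def f.zero norm_divide)
      also have "\<dots> \<le> 1 / 1" using w1 n1 by (intro frac_le) auto
      finally show "cmod (g 0) \<le> 1" by simp
      fix z :: complex assume z: "z \<in> cball 0 1"
      hence "f (z / 2) \<in> ?K" by auto
      hence "f (z / 2) \<noteq> w1" "f (z / 2) \<noteq> w2" using w1 w2 by auto
      thus "\<not> (g z = 0 \<or> g z = 1)" using ne by (simp add: g_def)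
    qed auto
    have fb: "cmod (f x) \<le> 1 + 3 * C" if "cmod (0 - x) = 1/4" for x
    proof -
      have "f x = w1 + (w2 - w1) * g (2 * x)" using ne by (simp add: g_def)
      hence "cmod (f x) \<le> cmod w1 + cmod (w2 - w1) * cmod (g (2 * x))"
        using norm_triangle_ineq[of w1 "(w2 - w1) * g (2 * x)"] by (simp only: norm_mult)
      also have "\<dots> \<le> 1 + 3 * C"
        using w1 n1 gb[of "2 * x"] that by (intro add_mono mult_mono) (auto simp: norm_mult)
      finally show ?thesis .
    qed
    have "cmod ((deriv ^^ n) f 0) \<le> fact n * (1 + 3 * C) / (1/4) ^ n"
      by (rule Cauchy_inequality[OF _ _ _ fb]) (auto intro: holomorphic_on_subset[OF f.hol] f.cont)
    thus ?thesis
      by (simp add: taylor_coeff_def norm_divide norm_fact divide_simps power_divide mult_ac)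
  qed
  thus thesis by (rule that)
qed

text \<open>Makes the suprema taken over the class finite.\<close>

lemma second_invariant_bounded: "\<exists>B. \<forall>f. classS f \<longrightarrow> cmod (taylor_coeff f 2) \<le> B \<and> cmod (second_invariant f) \<le> B"
proof -
  obtain B where B: "\<And>f n. classS f \<Longrightarrow> cmod (taylor_coeff f n) \<le> B * 4 ^ n"
    using taylor_coeff_bound by blast
  have "cmod (taylor_coeff f 2) \<le> max (16 * B) ((16 * B)\<^sup>2 + 64 * B)
      \<and> cmod (second_invariant f) \<le> max (16 * B) ((16 * B)\<^sup>2 + 64 * B)" if f: "classS f" for f
  proof -
    have 2: "cmod (taylor_coeff f 2) \<le> 16 * B" using B[OF f, of 2] by simp
    have "cmod (second_invariant f) \<le> (cmod (taylor_coeff f 2))\<^sup>2 + cmod (taylor_coeff f 3)"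
      unfolding second_invariant_def norm_power[symmetric] by (rule norm_triangle_ineq4)
    also have "\<dots> \<le> (16 * B)\<^sup>2 + 64 * B"
      using 2 B[OF f, of 3] by (intro add_mono power_mono) auto
    finally show ?thesis using 2 by auto
  qed
  thus ?thesis by blast
qed

section \<open>Sharp bounds by the supremum argument\<close>

lemma mult_cnj_sgn: "z * cnj (sgn z) = of_real (cmod z)"
proof (cases "z = 0")
  case False
  thus ?thesis
    using complex_norm_square[of z] by (simp add: sgn_eq power2_eq_square divide_simps)
qed simp

text \<open>Keeps the sets under the suprema nonempty.\<close>

lemma classS_id: "classS (\<lambda>z. z)"
  by (auto simp: classS_def classA_def)

text \<open>The increment satisfies |p^2 - \<sigma> q| \<le> |p|^2 + |q| \<le> 1, so the supremum
  obeys M \<le> \<sigma>^2 M + (1 - \<sigma>^2)/\<sigma>^2. Hence M \<le> 1/\<sigma>^2, and \<sigma>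
  -> 1 gives the bound.\<close>

theorem second_invariant_le_one:
  assumes "classS f" shows "cmod (second_invariant f) \<le> 1"
proof -
  let ?V = "{cmod (second_invariant f) | f. classS f}"
  define M where "M = Sup ?V"
  have bdd: "bdd_above ?V" using second_invariant_bounded by (auto simp: bdd_above_def)
  have ub: "cmod (second_invariant f) \<le> M" if "classS f" for f
    unfolding M_def by (rule cSup_upper[OF _ bdd]) (use that in auto)
  have step: "M \<le> 1 / \<sigma>\<^sup>2" if sig: "1/2 < \<sigma>" "\<sigma> < 1" for \<sigma> :: real
  proof -
    have s2: "0 < \<sigma>\<^sup>2" "\<sigma>\<^sup>2 < 1" using sig by (auto simp: power_less_one_iff)
    have "Sup ?V \<le> \<sigma>\<^sup>2 * M + (1 - \<sigma>\<^sup>2) / \<sigma>\<^sup>2"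
    proof (rule cSup_least, goal_cases)
      case 1
      thus ?case using classS_id by blast
    next
      case (2 x)
      then obtain f where f: "classS f" "x = cmod (second_invariant f)" by blast
      have "1\<^sup>2 * cmod (second_invariant f) \<le> \<sigma>\<^sup>2 * M + (1 - \<sigma>\<^sup>2) / \<sigma>\<^sup>2"
      proof (rule le_at_one_of_le_left[of "\<lambda>r. r\<^sup>2 * cmod (second_invariant f)" "\<lambda>_. \<sigma>\<^sup>2 * M + (1 - \<sigma>\<^sup>2) / \<sigma>\<^sup>2"])
        fix r :: real assume r: "1/2 < r" "r < 1"
        have r0: "0 < r" and s0: "0 < \<sigma>" using r sig by auto
        obtain g and p q :: complex where g: "classS g" "cmod p \<le> 1" "cmod q \<le> 1 - (cmod p)\<^sup>2"
          "of_real (r\<^sup>2) * second_invariant f =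
             \<sigma>\<^sup>2 * second_invariant g + (1 - \<sigma>\<^sup>2) / \<sigma>\<^sup>2 * (p\<^sup>2 - \<sigma> * q)"
          by (rule loewner_coefficients[OF f(1) r0 r(2) s0 sig(2)]; rule that; assumption)
        have "cmod (p\<^sup>2 - of_real \<sigma> * q) \<le> (cmod p)\<^sup>2 + \<sigma> * cmod q"
          using norm_triangle_ineq4[of "p\<^sup>2" "of_real \<sigma> * q"] sig by (simp add: norm_mult norm_power)
        also have "\<sigma> * cmod q \<le> 1 * cmod q" using sig by (intro mult_right_mono) auto
        finally have le1: "cmod (p\<^sup>2 - of_real \<sigma> * q) \<le> 1" using g(3) by simp
        have "of_real (r\<^sup>2) * second_invariant f = of_real (\<sigma>\<^sup>2) * second_invariant g
            + of_real ((1 - \<sigma>\<^sup>2) / \<sigma>\<^sup>2) * (p\<^sup>2 - of_real \<sigma> * q)"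
          using g(4) by simp
        hence "r\<^sup>2 * cmod (second_invariant f) \<le> cmod (of_real (\<sigma>\<^sup>2) * second_invariant g)
            + cmod (of_real ((1 - \<sigma>\<^sup>2) / \<sigma>\<^sup>2) * (p\<^sup>2 - of_real \<sigma> * q))"
          using norm_triangle_ineq[of "of_real (\<sigma>\<^sup>2) * second_invariant g"
              "of_real ((1 - \<sigma>\<^sup>2) / \<sigma>\<^sup>2) * (p\<^sup>2 - of_real \<sigma> * q)"]
            norm_mult[of "of_real (r\<^sup>2)" "second_invariant f"]
          by (simp only: norm_of_real abs_of_nonneg zero_le_power2)
        also have "\<dots> = \<sigma>\<^sup>2 * cmod (second_invariant g) + (1 - \<sigma>\<^sup>2) / \<sigma>\<^sup>2 * cmod (p\<^sup>2 - of_real \<sigma> * q)"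
          unfolding norm_mult norm_of_real using s2 by simp
        also have "\<dots> \<le> \<sigma>\<^sup>2 * M + (1 - \<sigma>\<^sup>2) / \<sigma>\<^sup>2 * 1"
          using ub[OF g(1)] le1 s2 by (intro add_mono mult_left_mono) auto
        finally show "r\<^sup>2 * cmod (second_invariant f) \<le> \<sigma>\<^sup>2 * M + (1 - \<sigma>\<^sup>2) / \<sigma>\<^sup>2" by simp
      qed (auto intro!: continuous_intros)
      thus ?case using f(2) by simp
    qed
    hence "(1 - \<sigma>\<^sup>2) * M \<le> (1 - \<sigma>\<^sup>2) * (1 / \<sigma>\<^sup>2)" by (simp add: M_def[symmetric] algebra_simps)
    thus ?thesis using s2 by (simp only: mult_le_cancel_left_pos)
  qed
  have "M \<le> 1 / 1\<^sup>2"
    by (rule le_at_one_of_le_left[of "\<lambda>_. M" "\<lambda>\<sigma>. 1 / \<sigma>\<^sup>2"]) (auto intro!: continuous_intros step)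
  thus ?thesis using ub[OF assms] by simp
qed

text \<open>Since the step turns \<open>s\<close> into \<open>s * \<sigma>\<close>, the supremum is
  taken jointly over functions and parameters. It satisfies M \<le> \<sigma> M + 40 (1 -
  \<sigma>)^2, so M \<le> 40 (1 - \<sigma>) and the excess over 4 is at most 0.\<close>

theorem loewner_energy_le_four:
  assumes "classS f" "0 \<le> s" "s \<le> 1"
  shows "(Re (taylor_coeff f 2))\<^sup>2 - s * Re (second_invariant f) + s \<le> 4"
proof -
  define e where "e f s = (Re (taylor_coeff f 2))\<^sup>2 - s * Re (second_invariant f) + s - 4" for f s
  let ?V = "{e f s | f s. classS f \<and> 0 \<le> s \<and> s \<le> 1}"
  define M where "M = Sup ?V"
  obtain B where B: "\<And>f. classS f \<Longrightarrow> cmod (taylor_coeff f 2) \<le> B" "\<And>f. classS f \<Longrightarrow> cmod (second_invariant f) \<le> B"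
    using second_invariant_bounded by blast
  have bdd: "bdd_above ?V"
  proof (rule bdd_aboveI)
    fix x assume "x \<in> ?V"
    then obtain f s where f: "classS f" "0 \<le> s" "s \<le> 1" "x = e f s" by blast
    have "(Re (taylor_coeff f 2))\<^sup>2 \<le> B\<^sup>2"
      using B(1)[OF f(1)] abs_Re_le_cmod[of "taylor_coeff f 2"]
      by (intro abs_le_square_iff[THEN iffD1]) linarith
    moreover have "- s * Re (second_invariant f) \<le> 1 * B"
    proof -
      have "- s * Re (second_invariant f) \<le> s * cmod (second_invariant f)"
        using abs_Re_le_cmod[of "second_invariant f"] f(2) mult_left_mono[of "- Re (second_invariant f)" "cmod (second_invariant f)" s] by simp
      also have "\<dots> \<le> 1 * B" using f B(2)[OF f(1)] by (intro mult_mono) auto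
      finally show ?thesis .
    qed
    ultimately show "x \<le> B\<^sup>2 + B" using f by (simp add: e_def)
  qed
  have ub: "e f s \<le> M" if "classS f" "0 \<le> s" "s \<le> 1" for f s
    unfolding M_def by (rule cSup_upper[OF _ bdd]) (use that in auto)
  have step: "M \<le> 40 * (1 - \<sigma>)" if sig: "1/2 < \<sigma>" "\<sigma> < 1" for \<sigma> :: real
  proof -
    have "Sup ?V \<le> \<sigma> * M + 40 * (1 - \<sigma>)\<^sup>2"
    proof (rule cSup_least, goal_cases)
      case 1
      thus ?case using classS_id by (auto intro!: exI[of _ 0])
    next
      case (2 x)
      then obtain f s where f: "classS f" "0 \<le> s" "s \<le> 1" "x = e f s" by blast
      let ?u = "\<lambda>r. (r * Re (taylor_coeff f 2))\<^sup>2 - s * (r\<^sup>2 * Re (second_invariant f)) + s - 4"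
      have "?u 1 \<le> \<sigma> * M + 40 * (1 - \<sigma>)\<^sup>2"
      proof (rule le_at_one_of_le_left[of ?u "\<lambda>_. \<sigma> * M + 40 * (1 - \<sigma>)\<^sup>2"])
        fix r :: real assume r: "1/2 < r" "r < 1"
        have r0: "0 < r" and s0: "0 < \<sigma>" using r sig by auto
        obtain g and p q :: complex where g: "classS g" "cmod p \<le> 1" "cmod q \<le> 1 - (cmod p)\<^sup>2"
          "of_real r * taylor_coeff f 2 = \<sigma> * taylor_coeff g 2 + (1 - \<sigma>\<^sup>2) / \<sigma> * p"
          "of_real (r\<^sup>2) * second_invariant f =
             \<sigma>\<^sup>2 * second_invariant g + (1 - \<sigma>\<^sup>2) / \<sigma>\<^sup>2 * (p\<^sup>2 - \<sigma> * q)"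
          by (rule loewner_coefficients[OF f(1) r0 r(2) s0 sig(2)]; rule that; assumption)
        have Re_mult: "Re (of_real x * w) = x * Re w" for x w by simp
        have "?u r = (Re (of_real r * taylor_coeff f 2))\<^sup>2 - s * Re (of_real (r\<^sup>2) * second_invariant f) + s - 4"
          by (simp only: Re_mult)
        also have "\<dots> \<le> \<sigma> * e g (s * \<sigma>) + 40 * (1 - \<sigma>)\<^sup>2"
          unfolding e_def by (rule loewner_step_inequality[OF _ _ f(2,3) g(2-5)]) (use sig in auto)
        also have "\<sigma> * e g (s * \<sigma>) \<le> \<sigma> * M"
          using sig f mult_le_one[of s \<sigma>] by (intro mult_left_mono ub g) auto
        finally show "?u r \<le> \<sigma> * M + 40 * (1 - \<sigma>)\<^sup>2" by simp
      qed (auto intro!: continuous_intros)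
      thus ?case using f(4) by (simp add: e_def)
    qed
    hence "(1 - \<sigma>) * M \<le> (1 - \<sigma>) * (40 * (1 - \<sigma>))" by (simp add: M_def[symmetric] algebra_simps power2_eq_square)
    thus ?thesis using sig by (simp only: mult_le_cancel_left_pos)
  qed
  have "M \<le> 40 * (1 - 1)"
  proof (rule le_at_one_of_le_left[of "\<lambda>_. M" "\<lambda>\<sigma>. 40 * (1 - \<sigma>)"])
    show "M \<le> 40 * (1 - \<sigma>)" if "1/2 < \<sigma>" "\<sigma> < 1" for \<sigma> by (rule step[OF that])
  qed (auto intro!: continuous_intros)
  thus ?thesis using ub[OF assms] by (simp add: e_def)
qed

text \<open>The case s = 0 after a rotation that makes the second coefficient nonnegative.\<close>

theorem bieberbach_two:
  assumes f: "classS f" shows "cmod (taylor_coeff f 2) \<le> 2"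
proof (cases "taylor_coeff f 2 = 0")
  case False
  define u where "u = cnj (sgn (taylor_coeff f 2))"
  have u: "cmod u = 1" using False by (simp add: u_def norm_sgn)
  have "u * taylor_coeff f 2 = of_real (cmod (taylor_coeff f 2))"
    unfolding u_def using mult_cnj_sgn by (metis mult.commute)
  hence "(cmod (taylor_coeff f 2))\<^sup>2 \<le> 4"
    using loewner_energy_le_four[OF classS_rotate(1)[OF f u], of 0] unfolding classS_rotate(2)[OF f u] by simp
  thus ?thesis by (simp add: power2_le_imp_le[of _ 2])
qed simp

text \<open>The case s = 1. A rotation by \<open>u\<close> multiplies the third coefficient by
  \<open>u\<^sup>2\<close>, so a square root is needed to make it nonnegative. The terms in
  \<open>a\<close> combine to \<open>(Im a)\<^sup>2\<close>, which is nonnegative.\<close>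

theorem bieberbach_three:
  assumes f: "classS f" shows "cmod (taylor_coeff f 3) \<le> 3"
proof (cases "taylor_coeff f 3 = 0")
  case False
  define u where "u = csqrt (cnj (sgn (taylor_coeff f 3)))"
  have u2: "u\<^sup>2 = cnj (sgn (taylor_coeff f 3))" by (simp add: u_def)
  have u: "cmod u = 1" using False by (simp add: u_def norm_sgn)
  have a3: "u\<^sup>2 * taylor_coeff f 3 = of_real (cmod (taylor_coeff f 3))"
    unfolding u2 using mult_cnj_sgn by (metis mult.commute)
  define a where "a = u * taylor_coeff f 2"
  have "(Re a)\<^sup>2 - Re (a\<^sup>2 - of_real (cmod (taylor_coeff f 3))) + 1 \<le> 4"
    using loewner_energy_le_four[OF classS_rotate(1)[OF f u], of 1]
    unfolding second_invariant_def classS_rotate(2,3)[OF f u] a3 a_def by simp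
  moreover have "Re (a\<^sup>2) = (Re a)\<^sup>2 - (Im a)\<^sup>2" by (simp add: power2_eq_square)
  ultimately show ?thesis using zero_le_power2[of "Im a"] by (simp only: minus_complex.sel Re_complex_of_real)
qed simp

subsection \<open>Toeplitz determinants\<close>

text \<open>For real \<open>c\<close> with modulus at most 2 the zeros of the denominator lie on the
  unit circle; c = 2 is the Koebe function.\<close>

lemma classS_example:
  fixes c :: real
  assumes c: "\<bar>c\<bar> \<le> 2"
  defines "f \<equiv> \<lambda>z. z / (1 - of_real c * z + z\<^sup>2)"
  shows "classS f" "taylor_coeff f 2 = of_real c" "taylor_coeff f 3 = of_real (c\<^sup>2 - 1)"
proof -
  have nz: "1 - of_real c * z + z\<^sup>2 \<noteq> 0" if z: "z \<in> ball 0 1" for z :: complex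
  proof
    assume e: "1 - of_real c * z + z\<^sup>2 = 0"
    define x y where "x = Re z" and "y = Im z"
    have xy: "x\<^sup>2 + y\<^sup>2 < 1"
      using z by (simp add: x_def y_def flip: cmod_power2) (simp add: power_less_one_iff abs_square_less_1)
    have re: "1 - c * x + x\<^sup>2 - y\<^sup>2 = 0" and im: "y * (2 * x - c) = 0"
      using arg_cong[OF e, of Re] arg_cong[OF e, of Im]
      by (simp_all add: x_def y_def power2_eq_square algebra_simps)
    show False
    proof (cases "y = 0")
      case True
      have "\<bar>x\<bar> < 1" using xy True by (simp add: abs_square_less_1)
      hence "0 < (1 - \<bar>x\<bar>)\<^sup>2" by simp
      also have "(1 - \<bar>x\<bar>)\<^sup>2 = 1 - 2 * \<bar>x\<bar> + x\<^sup>2" by (simp add: power2_diff)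
      also have "c * x \<le> 2 * \<bar>x\<bar>" using c mult_mono[of "\<bar>c\<bar>" 2 "\<bar>x\<bar>" "\<bar>x\<bar>"] abs_ge_self[of "c * x"] by (simp add: abs_mult)
      hence "1 - 2 * \<bar>x\<bar> + x\<^sup>2 \<le> 1 - c * x + x\<^sup>2 - y\<^sup>2" using True by simp
      finally show False using re by simp
    next
      case False
      hence "c = 2 * x" using im by simp
      hence "1 - x\<^sup>2 - y\<^sup>2 = 0" using re by (simp add: power2_eq_square)
      thus False using xy by simp
    qed
  qed
  have hol: "f holomorphic_on ball 0 1"
    unfolding f_def by (intro holomorphic_intros) (use nz in auto)
  let ?F = "Abs_fps (taylor_coeff f)"
  have "(\<lambda>z. f z * (1 - of_real c * z + z\<^sup>2)) has_fps_expansion ?F * (1 - fps_const (of_real c) * fps_X + fps_X\<^sup>2)"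
    by (intro fps_expansion_intros has_fps_expansion_taylor hol)
  hence "(\<lambda>z. z) has_fps_expansion ?F * (1 - fps_const (of_real c) * fps_X + fps_X\<^sup>2)"
    by (rule has_fps_expansion_cong[THEN iffD1, rotated -1])
       (auto intro!: eventually_ball_at_0 simp: f_def nz)
  hence X: "?F * (1 - fps_const (of_real c) * fps_X + fps_X\<^sup>2) = fps_X"
    using fps_expansion_unique_complex has_fps_expansion_fps_X by blast
  \<comment> \<open>Written with shifts only, the identity is a recursion for the
    coefficients.\<close>
  have X': "?F - fps_const (of_real c) * (fps_X * ?F) + fps_X * (fps_X * ?F) = fps_X"
    by (subst X[symmetric]) (simp add: algebra_simps power2_eq_square)
  have 0: "taylor_coeff f 0 = 0" using arg_cong[OF X', of "\<lambda>F. fps_nth F 0"] by simp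
  have 1: "taylor_coeff f (Suc 0) = 1" using arg_cong[OF X', of "\<lambda>F. fps_nth F 1"] 0 by simp
  show 2: "taylor_coeff f 2 = of_real c"
    using arg_cong[OF X', of "\<lambda>F. fps_nth F 2"] 0 1 by (simp add: numeral_2_eq_2)
  show "taylor_coeff f 3 = of_real (c\<^sup>2 - 1)"
    using arg_cong[OF X', of "\<lambda>F. fps_nth F 3"] 1 2
    by (simp add: numeral_3_eq_3 numeral_2_eq_2 fps_X_nth algebra_simps)
  have "inj_on f (ball 0 1)"
  proof (rule inj_onI)
    fix z w assume zw: "z \<in> ball 0 1" "w \<in> ball 0 1" "f z = f w"
    have "z * (1 - of_real c * w + w\<^sup>2) = w * (1 - of_real c * z + z\<^sup>2)"
      using zw(3) nz[OF zw(1)] nz[OF zw(2)] by (simp add: f_def frac_eq_eq)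
    \<comment> \<open>The cross-multiplied equation factors, and the second factor cannot vanish
      inside the disc.\<close>
    hence "(z - w) * (1 - z * w) = 0" by (simp add: algebra_simps power2_eq_square)
    moreover have "cmod (z * w) < 1" using zw norm_mult_less[of z 1 w 1] by simp
    hence "1 - z * w \<noteq> 0" by auto
    ultimately show "z = w" by simp
  qed
  thus "classS f" using hol 0 1 by (simp add: classS_def classA_def taylor_coeff_0_1)
qed

text \<open>Expanding the squared modulus of the second invariant produces the mixed real part of
  the determinant.\<close>

lemma detT31_eq:
  "detT31 f = ((cmod (taylor_coeff f 2))\<^sup>2 - 1)\<^sup>2 - (cmod (second_invariant f))\<^sup>2"
proof -
  define a b where "a = taylor_coeff f 2" and "b = taylor_coeff f 3"
  have "(cmod (A - b))\<^sup>2 = (cmod A)\<^sup>2 + (cmod b)\<^sup>2 - 2 * Re (A * cnj b)" for A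
    unfolding cmod_power2 by (simp add: power2_eq_square algebra_simps)
  hence "(cmod (a\<^sup>2 - b))\<^sup>2 = (cmod (a\<^sup>2))\<^sup>2 + (cmod b)\<^sup>2 - 2 * Re (a\<^sup>2 * cnj b)" .
  also have "(cmod (a\<^sup>2))\<^sup>2 = ((cmod a)\<^sup>2)\<^sup>2" by (simp add: norm_power)
  finally show ?thesis
    unfolding detT31_def second_invariant_def Let_def a_def[symmetric] b_def[symmetric]
    by (simp add: power2_diff)
qed

text \<open>With x = |a2|^2 and y the modulus of the second invariant the determinant is (x - 1)^2 -
  y^2. The lower bound needs only y \<le> 1. For the upper one, x \<le> 3 is immediate; beyond that
  |a3| \<le> 3 gives y \<ge> x - 3, so the determinant is at most 4 x - 8 \<le> 8.\<close>

lemma detT31_bounds: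
  assumes f: "classS f" shows "- 1 \<le> detT31 f" "detT31 f \<le> 8"
proof -
  define x y where "x = (cmod (taylor_coeff f 2))\<^sup>2" and "y = cmod (second_invariant f)"
  have y: "0 \<le> y" "y \<le> 1" using second_invariant_le_one[OF f] by (auto simp: y_def)
  have x: "0 \<le> x" "x \<le> 4"
    using power_mono[OF bieberbach_two[OF f] norm_ge_zero, of 2] by (auto simp: x_def)
  have D: "detT31 f = (x - 1)\<^sup>2 - y\<^sup>2" by (simp add: detT31_eq x_def y_def)
  have "y\<^sup>2 \<le> 1" using y by (simp add: power_le_one)
  thus "- 1 \<le> detT31 f" unfolding D using zero_le_power2[of "x - 1"] by linarith
  have "x \<le> y + 3"
    using norm_triangle_ineq2[of "(taylor_coeff f 2)\<^sup>2" "taylor_coeff f 3"] bieberbach_three[OF f]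
    by (simp add: x_def y_def second_invariant_def norm_power)
  show "detT31 f \<le> 8"
  proof (cases "x \<le> 3")
    case True
    hence "(x - 1)\<^sup>2 \<le> 2\<^sup>2" using x by (intro abs_le_square_iff[THEN iffD1]) auto
    hence "(x - 1)\<^sup>2 \<le> 4" by simp
    thus ?thesis unfolding D using zero_le_power2[of y] by linarith
  next
    case False
    hence "(x - 3)\<^sup>2 \<le> y\<^sup>2" using \<open>x \<le> y + 3\<close> by (intro power_mono) auto
    moreover have "(x - 1)\<^sup>2 - (x - 3)\<^sup>2 = 4 * x - 8" by (simp add: power2_eq_square algebra_simps)
    ultimately show ?thesis unfolding D using x by linarith
  qed
qed

theorem theorem1:
  shows "(\<forall>f. classS f \<longrightarrow>
            -3 \<le> detT21 f \<and> detT21 f \<le> 1 \<and> -1 \<le> detT31 f \<and> detT31 f \<le> 8)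
       \<and> (\<exists>f. classS f \<and> detT21 f = -3)
       \<and> (\<exists>f. classS f \<and> detT21 f = 1)
       \<and> (\<exists>f. classS f \<and> detT31 f = -1)
       \<and> (\<exists>f. classS f \<and> detT31 f = 8)"
proof (intro conjI allI impI)
  fix f assume f: "classS f"
  show "-3 \<le> detT21 f" "detT21 f \<le> 1"
    using power_mono[OF bieberbach_two[OF f] norm_ge_zero, of 2] by (auto simp: detT21_def)
  show "-1 \<le> detT31 f" "detT31 f \<le> 8" by (rule detT31_bounds[OF f])+
next
  \<comment> \<open>The pairs (a2, a3) are (2, 3), (0, -1) and (1, 0) for c = 2, 0 and 1.\<close>
  let ?f = "\<lambda>c::real. \<lambda>z::complex. z / (1 - of_real c * z + z\<^sup>2)"
  show "\<exists>f. classS f \<and> detT21 f = -3"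
    using classS_example[of 2] by (intro exI[of _ "?f 2"]) (simp add: detT21_def)
  show "\<exists>f. classS f \<and> detT31 f = 8"
    using classS_example[of 2] by (intro exI[of _ "?f 2"]) (simp add: detT31_def)
  show "\<exists>f. classS f \<and> detT21 f = 1"
    using classS_example[of 0] by (intro exI[of _ "?f 0"]) (simp add: detT21_def)
  show "\<exists>f. classS f \<and> detT31 f = -1"
    using classS_example[of 1] by (intro exI[of _ "?f 1"]) (simp add: detT31_def)
qed

end
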